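(* Let $n\ge 2$, let $u\in h^\infty(\mathbb{R}^n_+)$, and let $x=(x',x_n)$ be an arbitrary point in $\mathbb{R}^n_+$. The sharp coefficient $\mathcal{C}_\infty(x)$ in the inequality $$|\nabla u(x)|\le \mathcal{C}_\infty(x)\,\|u\|_\infty$$ is given by $$\mathcal{C}_\infty(x)=\frac{4(n-1)^{(n-1)/2}\,\omega_{n-1}}{n^{n/2}\,\omega_n\,x_n}.$$ Moreover, the absolute value of the derivative of $u$ with respect to the normal to the boundary of the half-space at any $x\in\mathbb{R}^n_+$ has the same supremum as $|\nabla u(x)|$; that is, for every $x\in\mathbb{R}^n_+$, $$\sup\left\{\left|\frac{\partial u}{\partial x_n}(x)\right| : u\in h^\infty(\mathbb{R}^n_+),\ \|u\|_\infty\le 1\right\}=\sup\left\{|\nabla u(x)| : u\in h^\infty(\mathbb{R}^n_+),\ \|u\|_\infty\le 1\right\}.$$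
   Context: $\mathbb{R}^n_+=\{x=(x',x_n): x'=(x_1,\dots,x_{n-1})\in\mathbb{R}^{n-1},\ x_n>0\}$. $\omega_k=2\pi^{k/2}/\Gamma(k/2)$ denotes the area of the unit sphere in $\mathbb{R}^k$ (so $\omega_1=2$). Functions are real-valued. $h^\infty(\mathbb{R}^n_+)$ is the space of harmonic functions on $\mathbb{R}^n_+$ that can be represented as the Poisson integral $$u(x)=\frac{2}{\omega_n}\int_{\mathbb{R}^{n-1}}\frac{x_n}{|y-x|^n}\,u(y')\,dy',\qquad y=(y',0),\ y'\in\mathbb{R}^{n-1},$$ with boundary values $u(y')$ in $L^\infty(\mathbb{R}^{n-1})$; $\|u\|_\infty$ denotes the $L^\infty(\mathbb{R}^{n-1})$ norm (essential supremum of the absolute value) of the boundary values. "Sharp coefficient" means the smallest constant (depending on $x$) for which the inequality holds for all $u\in h^\infty(\mathbb{R}^n_+)$. *)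

theory Defs
  imports "HOL-Analysis.Analysis" "HOL-Probability.Essential_Supremum"
begin

text \<open>
  Euclidean space of dimension \<open>n = CARD('m) + 1 \<ge> 2\<close> is rendered as \<^typ>\<open>(real^'m) \<times> real\<close>, a point
  being \<open>x = (x', x\<^sub>n)\<close>; the norm and inner product of the product type are the Euclidean ones.
\<close>

definition half_space :: "((real^'m) \<times> real) set" where
  "half_space = {x. snd x > 0}"

definition sphere_area :: "nat \<Rightarrow> real" where
  "sphere_area k = 2 * pi powr (real k / 2) / Gamma (real k / 2)"

text \<open>
  Partial derivatives are taken from the Frechet derivative; they are only used at points where
  the function is differentiable (by the definition of \<open>harmonic_on\<close>).
\<close>

definition partial :: "'a::euclidean_space \<Rightarrow> ('a \<Rightarrow> real) \<Rightarrow> 'a \<Rightarrow> real" where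
  "partial b u x = frechet_derivative u (at x) b"

definition grad :: "('a::euclidean_space \<Rightarrow> real) \<Rightarrow> 'a \<Rightarrow> 'a" where
  "grad u x = (\<Sum>b\<in>Basis. partial b u x *\<^sub>R b)"

text \<open>Intended for open \<open>S\<close>: \<open>u\<close> is twice continuously differentiable with vanishing Laplacian.\<close>

definition harmonic_on :: "'a::euclidean_space set \<Rightarrow> ('a \<Rightarrow> real) \<Rightarrow> bool" where
  "harmonic_on S u \<longleftrightarrow>
     (\<forall>x\<in>S. u differentiable (at x)) \<and>
     (\<forall>b\<in>Basis. \<forall>x\<in>S. partial b u differentiable (at x)) \<and>
     (\<forall>b\<in>Basis. \<forall>c\<in>Basis. continuous_on S (partial c (partial b u))) \<and>
     (\<forall>x\<in>S. (\<Sum>b\<in>Basis. partial b (partial b u) x) = 0)"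

definition Linfty :: "('a::euclidean_space \<Rightarrow> real) set" where
  "Linfty = {f \<in> borel_measurable lebesgue. esssup lebesgue (\<lambda>y. ereal \<bar>f y\<bar>) < \<infinity>}"

definition Linfty_norm :: "('a::euclidean_space \<Rightarrow> real) \<Rightarrow> real" where
  "Linfty_norm f = real_of_ereal (esssup lebesgue (\<lambda>y. ereal \<bar>f y\<bar>))"

definition poisson_integral :: "((real^'m) \<Rightarrow> real) \<Rightarrow> (real^'m) \<times> real \<Rightarrow> real" where
  "poisson_integral f x =
     2 / sphere_area (CARD('m) + 1) *
     (LINT y|lebesgue. snd x / norm ((y, 0) - x) ^ (CARD('m) + 1) * f y)"

definition boundary_values :: "((real^'m) \<times> real \<Rightarrow> real) \<Rightarrow> ((real^'m) \<Rightarrow> real) \<Rightarrow> bool" where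
  "boundary_values u f \<longleftrightarrow> f \<in> Linfty \<and> (\<forall>x\<in>half_space. u x = poisson_integral f x)"

text \<open>
  Elements are total functions whose values off \<^const>\<open>half_space\<close> are irrelevant.
\<close>

definition h_infty :: "((real^'m) \<times> real \<Rightarrow> real) set" where
  "h_infty = {u. harmonic_on half_space u \<and> (\<exists>f. boundary_values u f)}"

end

theory Submission
  imports Defs
begin

text \<open>
  Differentiating the Poisson integral, \<open>grad u(x) \<bullet> z\<close> is the integral of the boundary values against a
  kernel, so the sharp constant is the maximum over unit vectors \<open>z\<close> of the \<open>L\<^sup>1\<close> norm of that kernel,
  attained by the sign of the kernel. Central projection to the sphere turns this norm into
  a multiple of the mean of \<open>\<bar>z\<^sub>n - n \<sigma>\<^sub>n (\<sigma> \<bullet> z)\<bar>\<close>. Let \<open>p\<close>, \<open>q\<close> be the unit vectors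
  bisecting the angles between \<open>z\<close> and \<open>e\<^sub>n\<close>, and between \<open>-z\<close> and \<open>e\<^sub>n\<close>. With \<open>c = z\<^sub>n\<close>,
  \<open>z\<^sub>n - n \<sigma>\<^sub>n (\<sigma> \<bullet> z) = (1 + c)/2 (1 - n (\<sigma> \<bullet> p)\<^sup>2) - (1 - c)/2 (1 - n (\<sigma> \<bullet> q)\<^sup>2)\<close>,
  and by rotation invariance both terms on the right have the same mean absolute value as
  \<open>1 - n \<sigma>\<^sub>n\<^sup>2\<close>. Hence the maximum is attained at \<open>z = e\<^sub>n\<close>, where it is an elementary
  radial integral.
\<close>

section \<open>Lebesgue measure: isometries and polar coordinates\<close>

text \<open>The two bisecting directions come from diagonalising a quadratic form: with e the unit
  normal and c = \<open>z \<bullet> e\<close>, the form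
  \<open>(w \<bullet> z) * (w \<bullet> e)\<close> has eigenvalues (1 + c)/2 and -(1 - c)/2, with
  eigenvectors along e + z and e - z. The absolute values of the eigenvalues add up to 1, so the
  triangle inequality cannot exceed the value at z = e. The powers of n - 1 and n in the constant
  are the maximum of r^(n-1) / (1 + r^2)^(n/2), reached at r = sqrt (n - 1), the radius at which the
  normal derivative of the kernel changes sign. Directions are compared through
  \<open>ennreal\<close> integrals, and integrability of the differentiated kernel is read off from
  the resulting finite bound. Membership in \<open>h_infty\<close> demands harmonicity besides the
  integral representation. The extremal function is therefore admissible only after two
  differentiations under the integral sign, which is the purpose of the second derivatives of the
  kernel and of a majorant that serves all orders at once.\<close>

lemma nn_integral_lborel_affine:
  fixes f :: "'a::euclidean_space \<Rightarrow> ennreal"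
  assumes [measurable]: "f \<in> borel_measurable borel" and "c \<noteq> 0"
  shows "(\<integral>\<^sup>+x. f x \<partial>lborel) = ennreal (\<bar>c\<bar> ^ DIM('a)) * (\<integral>\<^sup>+x. f (t + c *\<^sub>R x) \<partial>lborel)"
  by (subst lborel_affine[OF \<open>c \<noteq> 0\<close>, of t])
     (simp add: nn_integral_density nn_integral_distr nn_integral_cmult)

text \<open>
  Uniqueness of Haar measure for the image of \<^const>\<open>lborel\<close> under \<open>T\<close>: integrating
  \<open>f (T x) g (y - T x)\<close> over \<open>x\<close> and \<open>y\<close> in both orders, with \<open>g\<close> the indicator of the unit ball, shows
  that the two measures are proportional, and both give the unit ball the same mass.
\<close>

lemma nn_integral_lborel_isometry:
  fixes f :: "'a::euclidean_space \<Rightarrow> ennreal"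
  assumes f[measurable]: "f \<in> borel_measurable borel"
    and T: "linear (T :: 'a \<Rightarrow> 'a)" "\<And>x. norm (T x) = norm x"
  shows "(\<integral>\<^sup>+x. f (T x) \<partial>lborel) = (\<integral>\<^sup>+x. f x \<partial>lborel)"
proof -
  have ot: "orthogonal_transformation T"
    using T by (simp add: orthogonal_transformation)
  have contT: "continuous_on UNIV T"
    using T(1) linear_continuous_on linear_conv_bounded_linear by blast
  have [measurable]: "T \<in> borel_measurable borel"
    using contT by (rule borel_measurable_continuous_onI)
  have trans: "(\<integral>\<^sup>+x. h (t + x) \<partial>lborel) = (\<integral>\<^sup>+x. h x \<partial>lborel)"
    if "h \<in> borel_measurable borel" for h :: "'a \<Rightarrow> ennreal" and t
    using nn_integral_lborel_affine[OF that, of 1 t] by simp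
  \<comment> \<open>\<open>T\<close> is onto, so a translation after \<open>T\<close> is a
    translation before it: the image measure is translation invariant too.\<close>
  have transT: "(\<integral>\<^sup>+x. h (t + T x) \<partial>lborel) = (\<integral>\<^sup>+x. h (T x) \<partial>lborel)"
    if [measurable]: "h \<in> borel_measurable borel" for h :: "'a \<Rightarrow> ennreal" and t
  proof -
    obtain s where s: "t = T s"
      using orthogonal_transformation_surj[OF ot] by blast
    have "(\<integral>\<^sup>+x. h (t + T x) \<partial>lborel) = (\<integral>\<^sup>+x. h (T (s + x)) \<partial>lborel)"
      by (simp add: s linear_add[OF T(1)])
    also have "\<dots> = (\<integral>\<^sup>+x. h (T x) \<partial>lborel)"
      by (rule trans) measurable
    finally show ?thesis .
  qed
  define g :: "'a \<Rightarrow> ennreal" where "g = indicator (ball 0 1)"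
  have [measurable]: "g \<in> borel_measurable borel"
    unfolding g_def by (intro borel_measurable_indicator borel_open open_ball)
  have gm: "g (- x) = g x" "g (T x) = g x" for x
    by (auto simp: g_def indicator_def T)
  define v where "v = (\<integral>\<^sup>+x. g x \<partial>lborel)"
  have "unit_ball_vol (real DIM('a)) \<noteq> 0"
    by (metis less_irrefl of_nat_0_le_iff unit_ball_vol_pos)
  then have v: "v \<noteq> 0" "v \<noteq> top"
    unfolding v_def g_def
    by (auto simp: emeasure_ball)
  have "(\<integral>\<^sup>+x. f (T x) \<partial>lborel) * v = (\<integral>\<^sup>+x. f (T x) * (\<integral>\<^sup>+y. g y \<partial>lborel) \<partial>lborel)"
    by (simp add: v_def nn_integral_multc)
  also have "\<dots> = (\<integral>\<^sup>+x. f (T x) * (\<integral>\<^sup>+y. g (- T x + y) \<partial>lborel) \<partial>lborel)"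
    by (subst trans) auto
  also have "\<dots> = (\<integral>\<^sup>+x. (\<integral>\<^sup>+y. f (T x) * g (y - T x) \<partial>lborel) \<partial>lborel)"
    by (simp add: nn_integral_cmult)
  also have "\<dots> = (\<integral>\<^sup>+y. (\<integral>\<^sup>+x. f (T x) * g (y - T x) \<partial>lborel) \<partial>lborel)"
    by (rule lborel_pair.Fubini') measurable
  also have "\<dots> = (\<integral>\<^sup>+y. (\<integral>\<^sup>+x. f (y + T x) * g (- T x) \<partial>lborel) \<partial>lborel)"
  proof (rule nn_integral_cong)
    show "(\<integral>\<^sup>+x. f (T x) * g (y - T x) \<partial>lborel) = (\<integral>\<^sup>+x. f (y + T x) * g (- T x) \<partial>lborel)" for y
      using transT[where h="\<lambda>x. f x * g (y - x)" and t=y] by simp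
  qed
  also have "\<dots> = (\<integral>\<^sup>+x. (\<integral>\<^sup>+y. f (y + T x) * g (- T x) \<partial>lborel) \<partial>lborel)"
    by (rule lborel_pair.Fubini') measurable
  also have "\<dots> = (\<integral>\<^sup>+x. (\<integral>\<^sup>+y. f (T x + y) \<partial>lborel) * g (- T x) \<partial>lborel)"
    by (simp add: nn_integral_multc add.commute)
  \<comment> \<open>The inner integral no longer depends on x, and \<open>g (- T x) = g x\<close>
    because the ball is symmetric and \<open>T\<close> preserves norms.\<close>
  also have "\<dots> = (\<integral>\<^sup>+x. f x \<partial>lborel) * v"
    by (subst trans) (auto simp: nn_integral_cmult gm v_def)
  finally show ?thesis
    using v by (simp add: ennreal_mult_cancel_left mult.commute[of _ v])
qed

text \<open>The law of the norm is determined by its values on the sets \<open>{..a}\<close>, which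
  are ball volumes proportional to the power d = \<open>DIM('a)\<close> of a. The density is the
  derivative of that volume, since the surface area is d times the volume of the unit ball.\<close>

lemma nn_integral_lborel_radial:
  fixes g :: "real \<Rightarrow> ennreal"
  assumes [measurable]: "g \<in> borel_measurable borel"
  shows "(\<integral>\<^sup>+x. g (norm (x::'a::euclidean_space)) \<partial>lborel) =
    (\<integral>\<^sup>+r. ennreal (sphere_area DIM('a) * r ^ (DIM('a) - 1)) * indicator {0..} r * g r \<partial>lborel)"
proof -
  let ?d = "DIM('a)"
  let ?w = "\<lambda>r::real. ennreal (sphere_area ?d * r ^ (?d - 1)) * indicator {0..} r"
  have sph: "sphere_area ?d = real ?d * unit_ball_vol (real ?d)"
  proof -
    have G: "Gamma (real ?d / 2 + 1) = real ?d / 2 * Gamma (real ?d / 2)"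
      by (rule Gamma_plus1) (auto dest: nonpos_Ints_nonpos)
    moreover have "Gamma (real ?d / 2) > 0"
      by (simp add: Gamma_real_pos)
    moreover have "real ?d > 0" by simp
    ultimately show ?thesis
      unfolding sphere_area_def unit_ball_vol_def G by simp
  qed
  have eq: "distr lborel borel (norm :: 'a \<Rightarrow> real) = density lborel ?w"
  proof (rule measure_eqI_generator_eq[where E="range (\<lambda>a::real. {..a})" and \<Omega>=UNIV and A="\<lambda>i. {..real i}"])
    show "Int_stable (range (\<lambda>a::real. {..a}))"
      by (auto simp: Int_stable_def)
    show "sets (distr lborel borel norm) = sigma_sets UNIV (range (\<lambda>a::real. {..a}))"
         "sets (density lborel ?w) = sigma_sets UNIV (range (\<lambda>a::real. {..a}))"
      by (simp_all add: borel_eq_atMost)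
    show "(\<Union>i. {..real i}) = UNIV"
      by (auto simp: real_arch_simple)
    have cb: "emeasure (distr lborel borel (norm :: 'a \<Rightarrow> real)) {..a} = emeasure lborel (cball (0::'a) a)" for a
      by (subst emeasure_distr) (auto intro!: arg_cong[where f="emeasure lborel"])
    show "emeasure (distr lborel borel (norm :: 'a \<Rightarrow> real)) {..real i} \<noteq> \<infinity>" for i
      by (simp add: cb emeasure_cball)
    fix X assume "X \<in> range (\<lambda>a::real. {..a})"
    then obtain a where X: "X = {..a}" by auto
    show "emeasure (distr lborel borel (norm :: 'a \<Rightarrow> real)) X = emeasure (density lborel ?w) X"
    proof (cases "a \<ge> 0")
      case True
      have "emeasure (density lborel ?w) X = (\<integral>\<^sup>+r. ennreal (sphere_area ?d * r ^ (?d - 1)) * indicator {0..a} r \<partial>lborel)"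
        by (auto simp: X emeasure_density indicator_def intro!: nn_integral_cong)
      also have "\<dots> = unit_ball_vol (real ?d) * a ^ ?d - unit_ball_vol (real ?d) * 0 ^ ?d"
        by (rule nn_integral_FTC_Icc)
           (auto intro!: derivative_eq_intros simp: sph True)
      finally show ?thesis
        using True by (simp add: X cb emeasure_cball)
    next
      case False
      then have w0: "?w r * indicator {..a} r = 0" for r
        by (auto simp: indicator_def)
      have "emeasure (density lborel ?w) X = (\<integral>\<^sup>+r. ?w r * indicator {..a} r \<partial>lborel)"
        by (simp add: X emeasure_density)
      also have "\<dots> = 0"
        by (simp only: w0) simp
      finally have "emeasure (density lborel ?w) X = 0" .
      with False show ?thesis
        by (simp add: X cb)
    qed
  qed auto
  have "(\<integral>\<^sup>+x. g (norm (x::'a)) \<partial>lborel) = (\<integral>\<^sup>+r. g r \<partial>distr lborel borel (norm :: 'a \<Rightarrow> real))"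
    by (simp add: nn_integral_distr)
  also have "\<dots> = (\<integral>\<^sup>+r. ?w r * g r \<partial>lborel)"
    unfolding eq by (subst nn_integral_density) auto
  finally show ?thesis .
qed

section \<open>Two radial integrals over the boundary hyperplane\<close>

lemma sphere_area_pos: "k > 0 \<Longrightarrow> sphere_area k > 0"
  by (simp add: sphere_area_def Gamma_real_pos)

text \<open>With d = \<open>DIM('a)\<close>, the radial integrand r^(d-1) / (1 + r^2)^((d+1)/2) is
  at most 1 / (1 + r^2), the derivative of the arctangent. After rescaling, this gives the
  integrability of the Poisson kernel over the boundary.\<close>

lemma nn_integral_conformal_weight_finite:
  "(\<integral>\<^sup>+s. ennreal (1 / norm (s::'a::euclidean_space, 1::real) ^ (DIM('a) + 1)) \<partial>lborel) < \<infinity>"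
proof -
  let ?d = "DIM('a)"
  have sp: "sphere_area ?d > 0" by (simp add: sphere_area_pos)
  have "(\<integral>\<^sup>+s. ennreal (1 / norm (s::'a, 1::real) ^ (?d + 1)) \<partial>lborel)
      = (\<integral>\<^sup>+s. (\<lambda>r. ennreal (1 / sqrt (r\<^sup>2 + 1) ^ (?d + 1))) (norm (s::'a)) \<partial>lborel)"
    by (simp add: norm_Pair)
  also have "\<dots> = (\<integral>\<^sup>+r. ennreal (sphere_area ?d * r ^ (?d - 1)) * indicator {0..} r *
      ennreal (1 / sqrt (r\<^sup>2 + 1) ^ (?d + 1)) \<partial>lborel)"
    by (rule nn_integral_lborel_radial) measurable
  also have "\<dots> \<le> (\<integral>\<^sup>+r. ennreal (sphere_area ?d * (1 / (1 + r\<^sup>2))) * indicator {0..} r \<partial>lborel)"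
  proof (intro nn_integral_mono)
    fix r :: real
    have "r ^ (?d - 1) / sqrt (r\<^sup>2 + 1) ^ (?d + 1) \<le> 1 / (1 + r\<^sup>2)" if "r \<ge> 0"
    proof -
      have "r ^ (?d - 1) \<le> sqrt (r\<^sup>2 + 1) ^ (?d - 1)"
        using that by (intro power_mono real_le_rsqrt) auto
      moreover have "sqrt (r\<^sup>2 + 1) ^ (?d + 1) = sqrt (r\<^sup>2 + 1) ^ (?d - 1) * (1 + r\<^sup>2)"
      proof -
        have "?d + 1 = (?d - 1) + 2"
          using DIM_positive[where 'a='a] by linarith
        then have "sqrt (r\<^sup>2 + 1) ^ (?d + 1) = sqrt (r\<^sup>2 + 1) ^ (?d - 1) * (sqrt (r\<^sup>2 + 1))\<^sup>2"
          by (metis power_add)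
        then show ?thesis by simp
      qed
      moreover have "sqrt (r\<^sup>2 + 1) > 0" "1 + r\<^sup>2 > 0"
        by (auto simp: add_pos_nonneg add_nonneg_pos)
      ultimately show ?thesis
        by (simp add: divide_simps)
    qed
    then show "ennreal (sphere_area ?d * r ^ (?d - 1)) * indicator {0..} r * ennreal (1 / sqrt (r\<^sup>2 + 1) ^ (?d + 1))
      \<le> ennreal (sphere_area ?d * (1 / (1 + r\<^sup>2))) * indicator {0..} r"
      using sp mult_left_mono[of "r ^ (?d - 1) / sqrt (r\<^sup>2 + 1) ^ (?d + 1)" "1 / (1 + r\<^sup>2)" "sphere_area ?d"]
      by (auto simp: indicator_def ennreal_mult[symmetric] intro!: ennreal_leI)
  qed
  also have "\<dots> = ennreal (sphere_area ?d * (pi / 2) - sphere_area ?d * arctan 0)"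
  proof (rule nn_integral_FTC_atLeast)
    show "((\<lambda>r. sphere_area ?d * arctan r) \<longlongrightarrow> sphere_area ?d * (pi / 2)) at_top"
      by (intro tendsto_intros tendsto_arctan_at_top)
    show "DERIV (\<lambda>r. sphere_area ?d * arctan r) r :> sphere_area ?d * (1 / (1 + r\<^sup>2))" for r
      by (auto intro!: derivative_eq_intros simp: field_simps)
  qed (use sp in auto)
  finally show ?thesis
    by (simp add: order_le_less_trans)
qed

text \<open>Up to sign and the factor \<open>sphere_area d\<close>, the radial integrand is the
  derivative of a function that vanishes at 0 and at infinity, rises up to \<open>sqrt d\<close> and
  falls afterwards. The integral of its absolute value is therefore twice its maximum.\<close>

lemma nn_integral_abs_normal_derivative:
  fixes d defines "d \<equiv> DIM('a::euclidean_space)"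
  shows "(\<integral>\<^sup>+s. ennreal \<bar>1 / norm (s::'a, 1::real) ^ (d + 1) - real (d + 1) / norm (s, 1::real) ^ (d + 3)\<bar> \<partial>lborel)
    = ennreal (2 * sphere_area d * sqrt (real d) ^ d / sqrt (real (d + 1)) ^ (d + 1))"
proof -
  have dpos: "d > 0" by (simp add: d_def)
  have sp: "sphere_area d > 0" using dpos by (simp add: sphere_area_pos)
  \<comment> \<open>\<open>F\<close> is an antiderivative of the radial integrand, which changes sign at \<open>sqrt d\<close>.\<close>
  define F where "F r = r ^ d / sqrt (r\<^sup>2 + 1) ^ (d + 1)" for r :: real
  define F' where "F' r = r ^ (d - 1) * (real d - r\<^sup>2) / sqrt (r\<^sup>2 + 1) ^ (d + 3)" for r :: real
  have [measurable]: "F' \<in> borel_measurable borel" unfolding F'_def by measurable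
  have rho: "sqrt (r\<^sup>2 + 1) > 0" "(sqrt (r\<^sup>2 + 1))\<^sup>2 = r\<^sup>2 + 1" for r :: real
    by (auto simp: add_nonneg_pos)
  have deriv: "DERIV F r :> F' r" for r
  proof -
    define q where "q = sqrt (r\<^sup>2 + 1)"
    have q: "q > 0" "q * q = r * r + 1" using rho[of r] by (simp_all add: q_def power2_eq_square)
    have "DERIV (\<lambda>r. sqrt (r\<^sup>2 + 1)) r :> r / q"
      unfolding q_def using rho(1)[of r] by (auto intro!: derivative_eq_intros simp: field_simps)
    from DERIV_divide[OF DERIV_pow[of d r] DERIV_power[OF this, of "d + 1"], folded q_def]
    have "DERIV F r :> (real d * r ^ (d - 1) * q ^ (d + 1) - r ^ d * (real (d + 1) * q ^ d * (r / q))) / (q ^ (d + 1) * q ^ (d + 1))"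
      using q(1) by (simp add: F_def[abs_def] mult_ac)
    also have "(real d * r ^ (d - 1) * q ^ (d + 1) - r ^ d * (real (d + 1) * q ^ d * (r / q))) / (q ^ (d + 1) * q ^ (d + 1)) = F' r"
    proof -
      obtain e where e: "d = Suc e" using dpos by (cases d) auto
      have "real d * r ^ (d - 1) * q ^ (d + 1) - r ^ d * (real (d + 1) * q ^ d * (r / q))
         = r ^ (d - 1) * q ^ (d - 1) * (real d * (q * q) - real (d + 1) * r\<^sup>2)"
        using q(1) by (simp add: e field_simps power2_eq_square)
      also have "real d * (q * q) - real (d + 1) * r\<^sup>2 = real d - r\<^sup>2"
        unfolding q(2) by (simp add: algebra_simps power2_eq_square)
      finally have num: "real d * r ^ (d - 1) * q ^ (d + 1) - r ^ d * (real (d + 1) * q ^ d * (r / q))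
         = r ^ (d - 1) * q ^ (d - 1) * (real d - r\<^sup>2)" .
      have "q ^ (d - 1) * q ^ (d + 3) = q ^ (d + 1) * q ^ (d + 1)"
        unfolding power_add[symmetric] by (rule arg_cong[where f="power q"]) (simp add: e)
      then show ?thesis
        unfolding num F'_def q_def[symmetric] using q(1) by (simp add: frac_eq_eq mult_ac)
    qed
    finally show ?thesis .
  qed
  have lim: "((\<lambda>r. F r) \<longlongrightarrow> 0) at_top"
  proof (rule tendsto_sandwich)
    show "\<forall>\<^sub>F r in at_top. 0 \<le> F r"
      using eventually_ge_at_top[of 0] by eventually_elim (simp add: F_def)
    show "\<forall>\<^sub>F r in at_top. F r \<le> 1 / r"
      using eventually_gt_at_top[of 0]
    proof eventually_elim
      case (elim r)
      have "r ^ (d + 1) \<le> sqrt (r\<^sup>2 + 1) ^ (d + 1)"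
        using elim by (intro power_mono real_le_rsqrt) auto
      then show ?case
        using elim rho(1)[of r] by (simp add: F_def divide_simps mult.commute)
    qed
    show "((\<lambda>r::real. 1 / r) \<longlongrightarrow> 0) at_top"
      using tendsto_inverse_0_at_top[OF filterlim_ident] by (simp add: divide_inverse)
  qed simp
  have F0: "F 0 = 0" using dpos by (simp add: F_def)
  let ?a = "sqrt (real d)"
  have a: "?a > 0" using dpos by simp
  have Fa: "F ?a = sqrt (real d) ^ d / sqrt (real (d + 1)) ^ (d + 1)"
    by (simp add: F_def add.commute)
  have sgn1: "F' r \<ge> 0" if "0 \<le> r" "r \<le> ?a" for r
    using power_mono[OF that(2,1), of 2] that by (auto simp: F'_def)
  have sgn2: "F' r \<le> 0" if "?a \<le> r" for r
  proof -
    have "r\<^sup>2 \<ge> real d" using power_mono[OF that, of 2] by simp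
    moreover have "0 \<le> r" using a that by linarith
    ultimately show ?thesis
      by (auto simp: F'_def intro!: divide_nonpos_nonneg mult_nonneg_nonpos)
  qed
  have "(\<integral>\<^sup>+s. ennreal \<bar>1 / norm (s::'a, 1::real) ^ (d + 1) - real (d + 1) / norm (s, 1::real) ^ (d + 3)\<bar> \<partial>lborel)
    = (\<integral>\<^sup>+s. (\<lambda>r. ennreal \<bar>1 / sqrt (r\<^sup>2 + 1) ^ (d + 1) - real (d + 1) / sqrt (r\<^sup>2 + 1) ^ (d + 3)\<bar>) (norm (s::'a)) \<partial>lborel)"
    by (simp add: norm_Pair)
  also have "\<dots> = (\<integral>\<^sup>+r. ennreal (sphere_area d * r ^ (d - 1)) * indicator {0..} r *
      ennreal \<bar>1 / sqrt (r\<^sup>2 + 1) ^ (d + 1) - real (d + 1) / sqrt (r\<^sup>2 + 1) ^ (d + 3)\<bar> \<partial>lborel)"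
    unfolding d_def by (rule nn_integral_lborel_radial) measurable
  also have "\<dots> = (\<integral>\<^sup>+r. ennreal (sphere_area d * \<bar>F' r\<bar>) * indicator {0..} r \<partial>lborel)"
  proof (intro nn_integral_cong)
    fix r :: real
    let ?q = "sqrt (r\<^sup>2 + 1)"
    have "1 / ?q ^ (d + 1) - real (d + 1) / ?q ^ (d + 3) = (?q\<^sup>2 - real (d + 1)) / ?q ^ (d + 3)"
    proof -
      have "1 / q ^ (d + 1) - real (d + 1) / q ^ (d + 3) = (q\<^sup>2 - real (d + 1)) / q ^ (d + 3)" if "q > 0" for q :: real
        using that by (simp add: field_simps power_add power2_eq_square power3_eq_cube)
      from this[OF rho(1)] show ?thesis .
    qed
    also have "\<dots> = - ((real d - r\<^sup>2) / ?q ^ (d + 3))"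
      unfolding rho(2) minus_divide_left by simp
    finally have "r ^ (d - 1) * \<bar>1 / ?q ^ (d + 1) - real (d + 1) / ?q ^ (d + 3)\<bar> = \<bar>F' r\<bar>" if "r \<ge> 0"
      using that by (simp only: F'_def abs_minus_cancel times_divide_eq_right[symmetric] abs_mult) simp
    then show "ennreal (sphere_area d * r ^ (d - 1)) * indicator {0..} r *
        ennreal \<bar>1 / ?q ^ (d + 1) - real (d + 1) / ?q ^ (d + 3)\<bar>
      = ennreal (sphere_area d * \<bar>F' r\<bar>) * indicator {0..} r"
      using sp by (auto simp: indicator_def ennreal_mult''[symmetric] mult.assoc)
  qed
  also have "\<dots> = (\<integral>\<^sup>+r. (ennreal (sphere_area d * F' r) * indicator {0..?a} r +
      ennreal (sphere_area d * - F' r) * indicator {?a..} r) \<partial>lborel)"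
  proof (intro nn_integral_cong_AE)
    \<comment> \<open>The two closed intervals share the endpoint \<open>sqrt d\<close>, which is
      discarded as a null set.\<close>
    have "AE r in lborel. r \<noteq> ?a" by (rule AE_lborel_singleton)
    then show "AE r in lborel. ennreal (sphere_area d * \<bar>F' r\<bar>) * indicator {0..} r =
      ennreal (sphere_area d * F' r) * indicator {0..?a} r +
      ennreal (sphere_area d * - F' r) * indicator {?a..} r"
    proof eventually_elim
      case (elim r)
      then show ?case
      proof -
        consider "r < 0" | "0 \<le> r" "r < ?a" | "?a < r"
          using elim by linarith
        then show ?thesis
        proof cases
          case 1
          then have "\<not> ?a \<le> r" using a by linarith
          with 1 show ?thesis by (simp add: indicator_def)
        next
          case 2
          then show ?thesis using sgn1[of r] by (simp add: indicator_def)
        next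
          case 3
          then have "0 \<le> r" using a by linarith
          with 3 show ?thesis using sgn2[of r] by (simp add: indicator_def)
        qed
      qed
    qed
  qed
  also have "\<dots> = (\<integral>\<^sup>+r. ennreal (sphere_area d * F' r) * indicator {0..?a} r \<partial>lborel) +
      (\<integral>\<^sup>+r. ennreal (sphere_area d * - F' r) * indicator {?a..} r \<partial>lborel)"
    by (rule nn_integral_add) measurable
  also have "(\<integral>\<^sup>+r. ennreal (sphere_area d * F' r) * indicator {0..?a} r \<partial>lborel)
      = ennreal (sphere_area d * F ?a - sphere_area d * F 0)"
    using a sp sgn1 by (intro nn_integral_FTC_Icc DERIV_cmult deriv mult_nonneg_nonneg) auto
  also have "(\<integral>\<^sup>+r. ennreal (sphere_area d * - F' r) * indicator {?a..} r \<partial>lborel)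
      = ennreal (sphere_area d * - 0 - sphere_area d * - F ?a)"
    using a sp sgn2
    by (intro nn_integral_FTC_atLeast DERIV_cmult DERIV_minus deriv mult_nonneg_nonneg tendsto_intros lim) auto
  also have "ennreal (sphere_area d * F ?a - sphere_area d * F 0) + ennreal (sphere_area d * - 0 - sphere_area d * - F ?a)
      = ennreal (2 * sphere_area d * F ?a)"
  proof -
    have "F ?a \<ge> 0" by (simp add: F_def)
    then show ?thesis
      using sp by (subst ennreal_plus[symmetric]) (auto simp: F0 mult.assoc)
  qed
  finally show ?thesis
    by (simp add: Fa)
qed

section \<open>The normal direction is extremal\<close>

text \<open>
  Integrals over \<open>S\<^sup>d\<close> are replaced by integrals of functions homogeneous of degree 0 over the unit
  ball; central projection onto the hyperplane \<open>w\<^sub>n = 1\<close> is then a scaling on each horizontal slice.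
\<close>

lemma nn_integral_homogeneous_cball:
  fixes q :: "'a::euclidean_space \<times> real \<Rightarrow> ennreal"
  assumes [measurable]: "q \<in> borel_measurable borel"
    and hom: "\<And>t w. t \<noteq> 0 \<Longrightarrow> q (t *\<^sub>R w) = q w"
  shows "(\<integral>\<^sup>+w. q w * indicator (cball 0 1) w \<partial>lborel) =
    (\<integral>\<^sup>+t. ennreal (\<bar>t\<bar> ^ DIM('a)) * indicator {-1..1} t \<partial>lborel) *
    (\<integral>\<^sup>+s. q (s, 1) * ennreal (1 / norm (s, 1::real) ^ (DIM('a) + 1)) \<partial>lborel)"
proof -
  let ?d = "DIM('a)"
  let ?I = "\<lambda>a t. indicator {-1..1::real} (t * a) :: ennreal"
  have rho: "norm (s, 1::real) > 0" for s :: 'a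
    by (simp add: norm_Pair add_nonneg_pos)
  have [measurable]: "cball (0::'a \<times> real) 1 \<in> sets borel"
    by (intro borel_closed closed_cball)
  have [measurable]: "cball (0::'a \<times> real) 1 \<in> sets (lborel \<Otimes>\<^sub>M lborel)"
    unfolding lborel_prod sets_lborel by (intro borel_closed closed_cball)
  have [measurable]: "q \<in> borel_measurable (lborel \<Otimes>\<^sub>M lborel)"
    unfolding lborel_prod by measurable
  have [measurable]: "(\<lambda>s::'a. (s, t::real)) \<in> borel_measurable borel" for t
    by (intro borel_measurable_continuous_onI continuous_intros)
  have "(\<integral>\<^sup>+w. q w * indicator (cball 0 1) w \<partial>lborel)
      = (\<integral>\<^sup>+t. (\<integral>\<^sup>+y. q (y, t) * indicator (cball 0 1) (y, t) \<partial>lborel) \<partial>lborel)"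
    unfolding lborel_prod[symmetric] by (rule lborel_pair.nn_integral_snd[symmetric]) measurable
  \<comment> \<open>Substitute \<open>y = t *\<^sub>R s\<close> on the slice at height t.
    Homogeneity removes t from \<open>q\<close>, and the ball becomes the condition that t times
    \<open>norm (s, 1)\<close> lies between -1 and 1.\<close>
  also have "\<dots> = (\<integral>\<^sup>+t. (\<integral>\<^sup>+s. ennreal (\<bar>t\<bar> ^ ?d) * (q (s, 1) * ?I (norm (s, 1::real)) t) \<partial>lborel) \<partial>lborel)"
  proof (rule nn_integral_cong_AE)
    have "AE t in lborel. t \<noteq> (0::real)" by (rule AE_lborel_singleton)
    then show "AE t in lborel. (\<integral>\<^sup>+y. q (y, t) * indicator (cball 0 1) (y, t) \<partial>lborel)
      = (\<integral>\<^sup>+s. ennreal (\<bar>t\<bar> ^ ?d) * (q (s, 1) * ?I (norm (s, 1::real)) t) \<partial>lborel)"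
    proof eventually_elim
      case (elim t)
      have "q (t *\<^sub>R s, t) * indicator (cball 0 1) (t *\<^sub>R s, t) = q (s, 1) * ?I (norm (s, 1::real)) t" for s
      proof -
        have e: "(t *\<^sub>R s, t) = t *\<^sub>R (s, 1)" by simp
        have "(t *\<^sub>R (s, 1::real) \<in> cball 0 1) \<longleftrightarrow> t * norm (s, 1::real) \<in> {-1..1}"
          using abs_le_iff[of "t * norm (s, 1::real)" 1] by (auto simp: mem_cball_0 abs_mult simp del: scaleR_Pair mem_cball)
        then show ?thesis
          unfolding e using hom[OF elim, of "(s, 1)"] by (simp add: indicator_def del: scaleR_Pair)
      qed
      then show ?case
        by (subst nn_integral_lborel_affine[OF _ elim, of _ 0])
           (simp_all add: nn_integral_cmult power_abs)
    qed
  qed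
  also have "\<dots> = (\<integral>\<^sup>+s. (\<integral>\<^sup>+t. ennreal (\<bar>t\<bar> ^ ?d) * (q (s, 1) * ?I (norm (s, 1::real)) t) \<partial>lborel) \<partial>lborel)"
    by (rule lborel_pair.Fubini') measurable
  \<comment> \<open>For fixed s, rescaling t to the interval from -1 to 1 costs one factor
    \<open>1 / norm (s, 1)\<close> for the length and \<open>DIM('a)\<close> more for the power of
    t. This is the Jacobian of the central projection.\<close>
  also have "\<dots> = (\<integral>\<^sup>+s. q (s, 1) * ennreal (1 / norm (s, 1::real) ^ (?d + 1)) *
      (\<integral>\<^sup>+t. ennreal (\<bar>t\<bar> ^ ?d) * indicator {-1..1} t \<partial>lborel) \<partial>lborel)"
  proof (rule nn_integral_cong)
    fix s :: 'a
    define a where "a = norm (s, 1::real)"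
    have a: "a > 0" using rho by (simp add: a_def)
    have "(\<integral>\<^sup>+t. ennreal (\<bar>t\<bar> ^ ?d) * (q (s, 1) * ?I a t) \<partial>lborel)
        = q (s, 1) * (\<integral>\<^sup>+t. ennreal (\<bar>t\<bar> ^ ?d) * ?I a t \<partial>lborel)"
      by (simp add: mult.left_commute nn_integral_cmult)
    also have "(\<integral>\<^sup>+t. ennreal (\<bar>t\<bar> ^ ?d) * ?I a t \<partial>lborel)
       = ennreal \<bar>1 / a\<bar> * (\<integral>\<^sup>+t. ennreal (\<bar>0 + 1 / a * t\<bar> ^ ?d) * ?I a (0 + 1 / a * t) \<partial>lborel)"
      using a by (intro nn_integral_real_affine) auto
    also have "\<dots> = ennreal \<bar>1 / a\<bar> * (\<integral>\<^sup>+t. ennreal ((1 / a) ^ ?d) * (ennreal (\<bar>t\<bar> ^ ?d) * indicator {-1..1} t) \<partial>lborel)"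
    proof -
      have "ennreal (\<bar>0 + 1 / a * t\<bar> ^ ?d) * ?I a (0 + 1 / a * t)
          = ennreal ((1 / a) ^ ?d) * (ennreal (\<bar>t\<bar> ^ ?d) * indicator {-1..1} t)" for t
      proof -
        have "\<bar>0 + 1 / a * t\<bar> ^ ?d = (1 / a) ^ ?d * \<bar>t\<bar> ^ ?d"
          using a by (simp add: power_divide)
        moreover have "(0 + 1 / a * t) * a = t"
          using a by simp
        ultimately show ?thesis
          using a by (simp add: ennreal_mult mult.assoc del: power_divide)
      qed
      then show ?thesis by presburger
    qed
    also have "\<dots> = ennreal (1 / a ^ (?d + 1)) * (\<integral>\<^sup>+t. ennreal (\<bar>t\<bar> ^ ?d) * indicator {-1..1} t \<partial>lborel)"
    proof -
      have "ennreal \<bar>1 / a\<bar> * ennreal ((1 / a) ^ ?d) = ennreal (1 / a ^ (?d + 1))"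
        using a by (simp add: ennreal_mult[symmetric] power_divide)
      then show ?thesis
        by (subst nn_integral_cmult) (simp_all add: mult.assoc[symmetric])
    qed
    finally show "(\<integral>\<^sup>+t. ennreal (\<bar>t\<bar> ^ ?d) * (q (s, 1) * ?I a t) \<partial>lborel)
      = q (s, 1) * ennreal (1 / a ^ (?d + 1)) * (\<integral>\<^sup>+t. ennreal (\<bar>t\<bar> ^ ?d) * indicator {-1..1} t \<partial>lborel)"
      by (simp add: mult.assoc)
  qed
  also have "\<dots> = (\<integral>\<^sup>+t. ennreal (\<bar>t\<bar> ^ ?d) * indicator {-1..1} t \<partial>lborel) *
    (\<integral>\<^sup>+s. q (s, 1) * ennreal (1 / norm (s, 1::real) ^ (?d + 1)) \<partial>lborel)"
    by (subst nn_integral_multc) (auto simp: mult.commute)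
  finally show ?thesis .
qed

text \<open>Allows the common radial factor to be cancelled in \<open>ennreal\<close>, where
  cancellation fails for 0 and \<open>top\<close>.\<close>

lemma abs_power_integral_finite_nonzero:
  "(\<integral>\<^sup>+t. ennreal (\<bar>t\<bar> ^ d) * indicator {-1..1} t \<partial>(lborel::real measure)) \<noteq> 0"
  "(\<integral>\<^sup>+t. ennreal (\<bar>t\<bar> ^ d) * indicator {-1..1} t \<partial>(lborel::real measure)) \<noteq> top"
proof -
  have "(\<integral>\<^sup>+t. ennreal (\<bar>t\<bar> ^ d) * indicator {-1..1} t \<partial>(lborel::real measure))
      \<ge> (\<integral>\<^sup>+t. ennreal (t ^ d) * indicator {0..1} t \<partial>(lborel::real measure))"
    by (intro nn_integral_mono) (auto simp: indicator_def)
  also have "(\<integral>\<^sup>+t. ennreal (t ^ d) * indicator {0..1} t \<partial>(lborel::real measure))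
      = ennreal (1 ^ (d + 1) / real (d + 1) - 0 ^ (d + 1) / real (d + 1))"
  proof (rule nn_integral_FTC_Icc)
    show "DERIV (\<lambda>t. t ^ (d + 1) / real (d + 1)) t :> t ^ d" for t
      using DERIV_cdivide[OF DERIV_pow[of "d + 1" t], of "real (d + 1)"]
      by (simp del: of_nat_add of_nat_Suc)
  qed auto
  finally show "(\<integral>\<^sup>+t. ennreal (\<bar>t\<bar> ^ d) * indicator {-1..1} t \<partial>(lborel::real measure)) \<noteq> 0"
    by (auto simp: ennreal_le_iff2 simp del: of_nat_Suc)
  have "(\<integral>\<^sup>+t. ennreal (\<bar>t\<bar> ^ d) * indicator {-1..1} t \<partial>(lborel::real measure))
      \<le> (\<integral>\<^sup>+t. indicator {-1..1} t \<partial>(lborel::real measure))"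
    by (intro nn_integral_mono) (auto simp: indicator_def power_le_one abs_le_iff)
  also have "\<dots> < top" by (simp add: ennreal_less_top)
  finally show "(\<integral>\<^sup>+t. ennreal (\<bar>t\<bar> ^ d) * indicator {-1..1} t \<partial>(lborel::real measure)) \<noteq> top"
    by simp
qed

lemma nn_integral_inner_rotate:
  fixes \<phi> :: "real \<Rightarrow> real \<Rightarrow> ennreal" and e p :: "'a::euclidean_space"
  assumes [measurable]: "(\<lambda>w::'a. \<phi> (w \<bullet> e) (norm w)) \<in> borel_measurable borel"
    and "norm e = norm p"
  shows "(\<integral>\<^sup>+w. \<phi> (w \<bullet> p) (norm w) \<partial>(lborel::'a measure)) = (\<integral>\<^sup>+w. \<phi> (w \<bullet> e) (norm w) \<partial>(lborel::'a measure))"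
proof (cases "e = p")
  case False
  \<comment> \<open>the reflection \<open>T\<close> along \<open>v\<close> exchanges \<open>e\<close> and \<open>p\<close>\<close>
  define v where "v = p - e"
  have v0: "v \<bullet> v \<noteq> 0" using False by (simp add: v_def)
  define T where "T w = w - (2 * (w \<bullet> v) / (v \<bullet> v)) *\<^sub>R v" for w
  have ee: "e \<bullet> e = p \<bullet> p" using assms(2) by (simp add: norm_eq)
  \<comment> \<open>This is where equal lengths enter: the identity says that
    \<open>T p = p - v = e\<close>.\<close>
  have vv: "v \<bullet> v = 2 * (p \<bullet> v)"
    by (simp add: v_def inner_diff_left inner_diff_right ee inner_commute)
  have lin: "linear T"
    unfolding T_def by (intro linearI) (simp_all add: algebra_simps inner_add_left add_divide_distrib scaleR_add_left)
  have nrm: "norm (T w) = norm w" for w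
  proof -
    have "T w \<bullet> T w = w \<bullet> w"
      using v0 by (simp add: T_def inner_diff_left inner_diff_right inner_commute field_simps)
    then show ?thesis by (simp add: norm_eq)
  qed
  have ip: "T w \<bullet> e = w \<bullet> p" for w
  proof -
    have "T w \<bullet> p = w \<bullet> p - w \<bullet> v"
      using v0 by (simp add: T_def inner_diff_left vv inner_commute[of v p])
    moreover have "T w \<bullet> v = - (w \<bullet> v)"
      using v0 by (simp add: T_def inner_diff_left)
    ultimately show ?thesis
      by (simp add: v_def inner_diff_right)
  qed
  show ?thesis
    using nn_integral_lborel_isometry[OF assms(1) lin nrm] by (simp add: ip nrm)
qed simp

text \<open>The hyperplane admits no rotation taking p to e in general, but the weight is the
  Jacobian that lifts the integral to the unit ball, where such isometries act. Squaring the inner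
  product makes the integrand even, so homogeneity also holds for negative factors.\<close>

lemma nn_integral_rotate_boundary:
  fixes p e :: "'a::euclidean_space \<times> real" and N :: real
  assumes "norm p = norm e"
  shows "(\<integral>\<^sup>+s. ennreal \<bar>1 - N * ((s, 1) \<bullet> p)\<^sup>2 / (norm (s::'a, 1::real))\<^sup>2\<bar> * ennreal (1 / norm (s, 1::real) ^ (DIM('a) + 1)) \<partial>lborel)
    = (\<integral>\<^sup>+s. ennreal \<bar>1 - N * ((s, 1) \<bullet> e)\<^sup>2 / (norm (s::'a, 1::real))\<^sup>2\<bar> * ennreal (1 / norm (s, 1::real) ^ (DIM('a) + 1)) \<partial>lborel)"
    (is "?L p = ?L e")
proof -
  define \<kappa> :: ennreal where "\<kappa> = (\<integral>\<^sup>+t. ennreal (\<bar>t\<bar> ^ DIM('a)) * indicator {-1..1} t \<partial>lborel)"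
  \<comment> \<open>The indicator carries the unit ball, so that the whole integrand depends on
    \<open>w \<bullet> p\<close> and \<open>norm w\<close> alone.\<close>
  define \<phi> :: "real \<Rightarrow> real \<Rightarrow> ennreal" where "\<phi> a r = ennreal \<bar>1 - N * a\<^sup>2 / r\<^sup>2\<bar> * indicator {..1} r" for a r
  have cone: "\<kappa> * ?L p = (\<integral>\<^sup>+w. \<phi> (w \<bullet> p) (norm w) \<partial>(lborel::('a \<times> real) measure))" for p
  proof -
    have "(\<integral>\<^sup>+w. ennreal \<bar>1 - N * (w \<bullet> p)\<^sup>2 / (norm (w::'a \<times> real))\<^sup>2\<bar> * indicator (cball 0 1) w \<partial>lborel) = \<kappa> * ?L p"
      unfolding \<kappa>_def
      by (rule nn_integral_homogeneous_cball) (auto simp: power_mult_distrib)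
    moreover have "ennreal \<bar>1 - N * (w \<bullet> p)\<^sup>2 / (norm (w::'a \<times> real))\<^sup>2\<bar> * indicator (cball 0 1) w = \<phi> (w \<bullet> p) (norm w)" for w
      by (simp add: \<phi>_def indicator_def)
    ultimately show ?thesis by simp
  qed
  have "(\<integral>\<^sup>+w. \<phi> (w \<bullet> p) (norm w) \<partial>(lborel::('a \<times> real) measure)) = (\<integral>\<^sup>+w. \<phi> (w \<bullet> e) (norm w) \<partial>(lborel::('a \<times> real) measure))"
    by (rule nn_integral_inner_rotate) (simp_all add: assms \<phi>_def)
  then have "\<kappa> * ?L p = \<kappa> * ?L e"
    by (simp only: cone)
  then show ?thesis
    using abs_power_integral_finite_nonzero[of "DIM('a)"]
    by (simp add: \<kappa>_def ennreal_mult_cancel_left)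
qed

text \<open>The weights (1 + c)/2 and (1 - c)/2 are nonnegative by Cauchy-Schwarz and add up to 1.
  The integral for \<open>z\<close> is thus bounded by a convex combination of two integrals that
  both equal the one for the normal.\<close>

lemma nn_integral_normal_direction_maximal:
  fixes z :: "'a::euclidean_space \<times> real" and N :: real
  assumes "norm z = 1"
  shows "(\<integral>\<^sup>+s. ennreal \<bar>snd z - N * ((s, 1) \<bullet> z) / (norm (s::'a, 1::real))\<^sup>2\<bar> * ennreal (1 / norm (s, 1::real) ^ (DIM('a) + 1)) \<partial>lborel)
    \<le> (\<integral>\<^sup>+s. ennreal \<bar>1 - N / (norm (s::'a, 1::real))\<^sup>2\<bar> * ennreal (1 / norm (s, 1::real) ^ (DIM('a) + 1)) \<partial>lborel)"
proof -
  define e :: "'a \<times> real" where "e = (0, 1)"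
  define c where "c = snd z"
  have e1: "norm e = 1" by (simp add: e_def norm_Pair)
  have ez: "e \<bullet> z = c" "z \<bullet> e = c" "\<And>s. (s, 1) \<bullet> e = 1"
    by (simp_all add: e_def c_def inner_prod_def)
  have c: "\<bar>c\<bar> \<le> 1"
    using Cauchy_Schwarz_ineq2[of e z] by (simp add: ez e1 assms)
  \<comment> \<open>If z is e or -e, one of e - z and e + z vanishes and has no direction. Any unit
    vector then serves, because its coefficient is 0.\<close>
  have unit: "\<exists>p. norm p = 1 \<and> a = norm a *\<^sub>R p" for a :: "'a \<times> real"
  proof (cases "a = 0")
    case True
    then have "norm e = 1 \<and> a = norm a *\<^sub>R e" using e1 by simp
    then show ?thesis by blast
  next
    case False
    then have "norm (sgn a) = 1 \<and> a = norm a *\<^sub>R sgn a"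
      by (simp add: norm_sgn sgn_div_norm)
    then show ?thesis by blast
  qed
  obtain p where p: "norm p = 1" "e + z = norm (e + z) *\<^sub>R p" using unit by blast
  obtain q where q: "norm q = 1" "e - z = norm (e - z) *\<^sub>R q" using unit by blast
  have ee: "e \<bullet> e = 1" "z \<bullet> z = 1"
    using e1 assms by (simp_all add: dot_square_norm)
  have np: "(norm (e + z))\<^sup>2 = 2 + 2 * c" and nq: "(norm (e - z))\<^sup>2 = 2 - 2 * c"
    by (simp_all add: power2_norm_eq_inner inner_add_left inner_add_right inner_diff_left inner_diff_right ee ez)
  have sq: "w \<bullet> z * (w \<bullet> e) = (1 + c) / 2 * (w \<bullet> p)\<^sup>2 - (1 - c) / 2 * (w \<bullet> q)\<^sup>2" for w
  proof -
    have "w \<bullet> (e + z) = norm (e + z) * (w \<bullet> p)" "w \<bullet> (e - z) = norm (e - z) * (w \<bullet> q)"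
      using arg_cong[OF p(2), of "inner w"] arg_cong[OF q(2), of "inner w"] by simp_all
    then have "(w \<bullet> (e + z))\<^sup>2 = (2 + 2 * c) * (w \<bullet> p)\<^sup>2" "(w \<bullet> (e - z))\<^sup>2 = (2 - 2 * c) * (w \<bullet> q)\<^sup>2"
      by (simp_all add: power_mult_distrib np nq)
    moreover have "4 * (w \<bullet> z * (w \<bullet> e)) = (w \<bullet> (e + z))\<^sup>2 - (w \<bullet> (e - z))\<^sup>2"
      by (simp add: inner_add_right inner_diff_right power2_eq_square algebra_simps)
    ultimately show ?thesis by (simp add: field_simps)
  qed
  let ?\<rho> = "\<lambda>s::'a. norm (s, 1::real)"
  let ?A = "\<lambda>p s. ennreal \<bar>1 - N * ((s, 1) \<bullet> p)\<^sup>2 / (?\<rho> s)\<^sup>2\<bar> * ennreal (1 / ?\<rho> s ^ (DIM('a) + 1))"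
  have "(\<integral>\<^sup>+s. ennreal \<bar>snd z - N * ((s, 1) \<bullet> z) / (?\<rho> s)\<^sup>2\<bar> * ennreal (1 / ?\<rho> s ^ (DIM('a) + 1)) \<partial>lborel)
     \<le> (\<integral>\<^sup>+s. ennreal ((1 + c) / 2) * ?A p s + ennreal ((1 - c) / 2) * ?A q s \<partial>lborel)"
  proof (rule nn_integral_mono)
    fix s :: 'a
    let ?a = "\<lambda>p. 1 - N * ((s, 1) \<bullet> p)\<^sup>2 / (?\<rho> s)\<^sup>2"
    \<comment> \<open>The factor \<open>(s, 1) \<bullet> e\<close>, which equals 1, turns the linear
      term into the quadratic form of \<open>sq\<close>; the constant splits with the same weights
      because c = (1 + c)/2 - (1 - c)/2.\<close>
    have "snd z - N * ((s, 1) \<bullet> z) / (?\<rho> s)\<^sup>2 = c - N / (?\<rho> s)\<^sup>2 * ((s, 1) \<bullet> z * ((s, 1) \<bullet> e))"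
      by (simp add: ez c_def)
    also have "\<dots> = (1 + c) / 2 * ?a p - (1 - c) / 2 * ?a q"
    proof -
      define K where "K = N / (?\<rho> s)\<^sup>2"
      have K: "?a p = 1 - K * ((s, 1) \<bullet> p)\<^sup>2" for p
        by (simp add: K_def)
      have "c - K * ((1 + c) / 2 * P - (1 - c) / 2 * Q)
          = (1 + c) / 2 * (1 - K * P) - (1 - c) / 2 * (1 - K * Q)" for P Q
        by (simp add: field_simps)
      then show ?thesis
        unfolding sq K K_def[symmetric] .
    qed
    also have "\<bar>\<dots>\<bar> \<le> (1 + c) / 2 * \<bar>?a p\<bar> + (1 - c) / 2 * \<bar>?a q\<bar>"
      using c by (intro order_trans[OF abs_triangle_ineq4]) (simp add: abs_mult)
    finally have "ennreal \<bar>snd z - N * ((s, 1) \<bullet> z) / (?\<rho> s)\<^sup>2\<bar>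
        \<le> ennreal ((1 + c) / 2) * ennreal \<bar>?a p\<bar> + ennreal ((1 - c) / 2) * ennreal \<bar>?a q\<bar>"
      using c by (simp add: ennreal_mult[symmetric] ennreal_plus[symmetric] del: ennreal_plus)
    from mult_right_mono[OF this, of "ennreal (1 / ?\<rho> s ^ (DIM('a) + 1))"]
    show "ennreal \<bar>snd z - N * ((s, 1) \<bullet> z) / (?\<rho> s)\<^sup>2\<bar> * ennreal (1 / ?\<rho> s ^ (DIM('a) + 1))
      \<le> ennreal ((1 + c) / 2) * ?A p s + ennreal ((1 - c) / 2) * ?A q s"
      by (simp add: distrib_right mult.assoc)
  qed
  also have "\<dots> = ennreal ((1 + c) / 2) * (\<integral>\<^sup>+s. ?A p s \<partial>lborel) + ennreal ((1 - c) / 2) * (\<integral>\<^sup>+s. ?A q s \<partial>lborel)"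
  proof -
    have [measurable]: "(\<lambda>s::'a. (s, 1::real)) \<in> borel_measurable borel"
      by (intro borel_measurable_continuous_onI continuous_intros)
    show ?thesis
      by (simp add: nn_integral_add nn_integral_cmult)
  qed
  also have "\<dots> = ennreal ((1 + c) / 2) * (\<integral>\<^sup>+s. ?A e s \<partial>lborel) + ennreal ((1 - c) / 2) * (\<integral>\<^sup>+s. ?A e s \<partial>lborel)"
    using nn_integral_rotate_boundary[of p e N] nn_integral_rotate_boundary[of q e N] p(1) q(1) e1 by simp
  also have "\<dots> = (\<integral>\<^sup>+s. ?A e s \<partial>lborel)"
    using c by (simp add: distrib_right[symmetric] ennreal_plus[symmetric] field_simps del: ennreal_plus)
  finally show ?thesis
    by (simp add: ez)
qed

section \<open>Differentiation under the integral sign\<close>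

text \<open>Dominated convergence is a statement about sequences; in a metric space limits at a
  point can be tested on sequences.\<close>

lemma tendsto_integral_dominated:
  fixes F :: "'x::metric_space \<Rightarrow> 'b \<Rightarrow> real"
  assumes "e > 0"
    and meas: "\<And>x. x \<in> ball x0 e \<Longrightarrow> F x \<in> borel_measurable M" "l \<in> borel_measurable M"
    and bound: "\<And>x y. x \<in> ball x0 e \<Longrightarrow> x \<noteq> x0 \<Longrightarrow> \<bar>F x y\<bar> \<le> g y" "integrable M g"
    and lim: "\<And>y. ((\<lambda>x. F x y) \<longlongrightarrow> l y) (at x0)"
  shows "((\<lambda>x. \<integral>y. F x y \<partial>M) \<longlongrightarrow> (\<integral>y. l y \<partial>M)) (at x0)"
proof -
  have at: "at x0 within ball x0 e = at x0"
    using \<open>e > 0\<close> by (intro at_within_open) auto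
  have "((\<lambda>x. \<integral>y. F x y \<partial>M) \<longlongrightarrow> (\<integral>y. l y \<partial>M)) (at x0 within ball x0 e)"
    unfolding tendsto_at_iff_sequentially
  proof (intro allI impI)
    fix X assume X: "\<forall>i. X i \<in> ball x0 e - {x0}" "X \<longlonglongrightarrow> x0"
    have "(\<lambda>i. \<integral>y. F (X i) y \<partial>M) \<longlonglongrightarrow> (\<integral>y. l y \<partial>M)"
    proof (rule integral_dominated_convergence[where w=g])
      show "AE y in M. (\<lambda>i. F (X i) y) \<longlonglongrightarrow> l y"
        using lim X unfolding tendsto_at_iff_sequentially by (auto simp: o_def)
      show "AE y in M. norm (F (X i) y) \<le> g y" for i
        using bound(1) X by auto
    qed (use meas bound X in auto)
    then show "((\<lambda>x. \<integral>y. F x y \<partial>M) \<circ> X) \<longlonglongrightarrow> (\<integral>y. l y \<partial>M)"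
      by (simp add: o_def)
  qed
  then show ?thesis by (simp add: at)
qed

text \<open>The mean value inequality on the convex ball bounds the increment of the integrand by
  \<open>g y * norm (x - x0)\<close>, and the linear term obeys the same bound. The remainder
  quotient is therefore dominated by \<open>2 * g y\<close> while it tends to 0 pointwise.\<close>

lemma has_derivative_integral_dominated:
  fixes k :: "'x::real_normed_vector \<Rightarrow> 'b \<Rightarrow> real"
  assumes "e > 0"
    and k: "\<And>x. x \<in> ball x0 e \<Longrightarrow> integrable M (k x)"
    and D: "\<And>x y. x \<in> ball x0 e \<Longrightarrow> ((\<lambda>x. k x y) has_derivative D x y) (at x)"
    and bound: "\<And>x y h. x \<in> ball x0 e \<Longrightarrow> \<bar>D x y h\<bar> \<le> g y * norm h" "integrable M g"
    and gpos: "\<And>y. 0 \<le> g y"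
    and meas: "\<And>h. (\<lambda>y. D x0 y h) \<in> borel_measurable M"
  shows "((\<lambda>x. \<integral>y. k x y \<partial>M) has_derivative (\<lambda>h. \<integral>y. D x0 y h \<partial>M)) (at x0)"
proof -
  have x0: "x0 \<in> ball x0 e" using \<open>e > 0\<close> by simp
  have lin: "bounded_linear (D x0 y)" for y
    using D[OF x0] by (rule has_derivative_bounded_linear)
  have intD: "integrable M (\<lambda>y. D x0 y h)" for h
  proof (rule Bochner_Integration.integrable_bound)
    show "integrable M (\<lambda>y. g y * norm h)" using bound(2) by simp
    show "AE y in M. norm (D x0 y h) \<le> norm (g y * norm h)"
      using bound(1)[OF x0] by (auto intro!: AE_I2 order_trans[OF _ abs_ge_self])
  qed (rule meas)
  show ?thesis
    unfolding has_derivative_at_within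
  proof
    show "bounded_linear (\<lambda>h. \<integral>y. D x0 y h \<partial>M)"
    proof (rule bounded_linear_intro[where K="\<integral>y. g y \<partial>M"])
      show "(\<integral>y. D x0 y (a + b) \<partial>M) = (\<integral>y. D x0 y a \<partial>M) + (\<integral>y. D x0 y b \<partial>M)" for a b
        using intD by (simp add: bounded_linear.linear[OF lin, THEN linear_add] )
      show "(\<integral>y. D x0 y (r *\<^sub>R a) \<partial>M) = r *\<^sub>R (\<integral>y. D x0 y a \<partial>M)" for r a
        by (simp add: bounded_linear.linear[OF lin, THEN linear_scale])
      show "norm (\<integral>y. D x0 y h \<partial>M) \<le> norm h * (\<integral>y. g y \<partial>M)" for h
      proof -
        have "norm (\<integral>y. D x0 y h \<partial>M) \<le> (\<integral>y. norm (D x0 y h) \<partial>M)"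
          by (rule integral_norm_bound)
        also have "\<dots> \<le> (\<integral>y. g y * norm h \<partial>M)"
          using bound intD x0 by (intro integral_mono) auto
        finally show ?thesis by (simp add: mult.commute)
      qed
    qed
    let ?Q = "\<lambda>x y. (k x y - k x0 y - D x0 y (x - x0)) /\<^sub>R norm (x - x0)"
    have "((\<lambda>x. \<integral>y. ?Q x y \<partial>M) \<longlongrightarrow> (\<integral>y. 0 \<partial>M)) (at x0)"
    proof (rule tendsto_integral_dominated[where e=e and g="\<lambda>y. 2 * g y"])
      show "?Q x \<in> borel_measurable M" if "x \<in> ball x0 e" for x
        using k[OF that] k[OF x0] intD by (intro borel_measurable_integrable) auto
      show "((\<lambda>x. ?Q x y) \<longlongrightarrow> 0) (at x0)" for y
        using D[OF x0, of y] unfolding has_derivative_at_within by blast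
      show "\<bar>?Q x y\<bar> \<le> 2 * g y" if x: "x \<in> ball x0 e" "x \<noteq> x0" for x y
      proof -
        have "norm (k x y - k x0 y) \<le> g y * norm (x - x0)"
        proof (rule differentiable_bound[where S="ball x0 e" and f'="\<lambda>x. D x y"])
          show "((\<lambda>x. k x y) has_derivative D z y) (at z within ball x0 e)" if "z \<in> ball x0 e" for z
            using D[OF that] by (rule has_derivative_at_withinI)
          show "onorm (D z y) \<le> g y" if "z \<in> ball x0 e" for z
            by (rule onorm_bound) (use bound(1)[OF that, of y] gpos in auto)
        qed (use x x0 in auto)
        moreover have "\<bar>D x0 y (x - x0)\<bar> \<le> g y * norm (x - x0)"
          by (rule bound(1)[OF x0])
        ultimately have "\<bar>k x y - k x0 y - D x0 y (x - x0)\<bar> \<le> (2 * g y) * norm (x - x0)"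
          unfolding real_norm_def by linarith
        then show ?thesis
          using x(2) by (simp add: abs_mult field_simps)
      qed
    qed (use \<open>e > 0\<close> bound in auto)
    then have "((\<lambda>x. \<integral>y. ?Q x y \<partial>M) \<longlongrightarrow> 0) (at x0)" by simp
    then show "((\<lambda>x. ((\<integral>y. k x y \<partial>M) - (\<integral>y. k x0 y \<partial>M) - (\<integral>y. D x0 y (x - x0) \<partial>M)) /\<^sub>R norm (x - x0)) \<longlongrightarrow> 0) (at x0)"
    proof (rule Lim_transform_within_open[where s="ball x0 e"])
      show "(\<integral>y. ?Q x y \<partial>M) = ((\<integral>y. k x y \<partial>M) - (\<integral>y. k x0 y \<partial>M) - (\<integral>y. D x0 y (x - x0) \<partial>M)) /\<^sub>R norm (x - x0)"
        if "x \<in> ball x0 e" for x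
        using k[OF that] k[OF x0] intD by simp
    qed (use \<open>e > 0\<close> in auto)
  qed
qed

section \<open>The Poisson kernel and its derivatives\<close>

lemma has_derivative_divide_norm_power:
  fixes p :: "'a::euclidean_space \<Rightarrow> real"
  assumes p: "(p has_derivative p') (at w)" and "w \<noteq> 0"
  shows "((\<lambda>w. p w / norm w ^ k) has_derivative
    (\<lambda>h. p' h / norm w ^ k - real k * p w * (w \<bullet> h) / norm w ^ (k + 2))) (at w)"
proof -
  have r: "norm w > 0" using \<open>w \<noteq> 0\<close> by simp
  have "(norm has_derivative (\<lambda>h. (w \<bullet> h) / norm w)) (at w)"
    using has_derivative_norm[OF \<open>w \<noteq> 0\<close>]
    by (simp add: sgn_div_norm inner_commute divide_inverse mult.commute)
  then have "((\<lambda>w. norm w ^ k) has_derivative (\<lambda>h. real k * ((w \<bullet> h) / norm w) * norm w ^ (k - 1))) (at w)"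
    by (rule has_derivative_power)
  from has_derivative_divide'[OF p this]
  have "((\<lambda>w. p w / norm w ^ k) has_derivative
    (\<lambda>h. (p' h * norm w ^ k - p w * (real k * ((w \<bullet> h) / norm w) * norm w ^ (k - 1))) / (norm w ^ k * norm w ^ k))) (at w)"
    using r by simp
  \<comment> \<open>For k = 0 the truncated exponent \<open>k - 1\<close> is harmless, since the
    factor \<open>real k\<close> vanishes.\<close>
  moreover have "(a * r ^ k - b * (real k * (c / r) * r ^ (k - 1))) / (r ^ k * r ^ k)
      = a / r ^ k - real k * b * c / r ^ (k + 2)" if "r > 0" for a b c r :: real
    using that by (cases k) (simp_all add: field_simps power2_eq_square)
  ultimately show ?thesis
    using r by simp
qed

text \<open>A function of the difference \<open>w = x - (y, 0)\<close>, so that differentiation in x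
  at every y is differentiation of one fixed function. The normalising factor 2 /
  \<open>sphere_area n\<close> stays outside the integrals.\<close>

definition poisson_kernel :: "'a::euclidean_space \<times> real \<Rightarrow> real" where
  "poisson_kernel w = snd w / norm w ^ (DIM('a) + 1)"

definition poisson_kernel_deriv :: "'a::euclidean_space \<times> real \<Rightarrow> 'a \<times> real \<Rightarrow> real" where
  "poisson_kernel_deriv b w = snd b / norm w ^ (DIM('a) + 1)
     - real (DIM('a) + 1) * snd w * (w \<bullet> b) / norm w ^ (DIM('a) + 3)"

definition poisson_kernel_deriv2 :: "'a::euclidean_space \<times> real \<Rightarrow> 'a \<times> real \<Rightarrow> 'a \<times> real \<Rightarrow> real" where
  "poisson_kernel_deriv2 b c w =
     - real (DIM('a) + 1) * (snd b * (w \<bullet> c) + snd c * (w \<bullet> b) + snd w * (b \<bullet> c)) / norm w ^ (DIM('a) + 3)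
     + real (DIM('a) + 1) * real (DIM('a) + 3) * snd w * (w \<bullet> b) * (w \<bullet> c) / norm w ^ (DIM('a) + 5)"

lemma poisson_kernel_has_derivative:
  fixes w :: "'a::euclidean_space \<times> real"
  assumes "snd w > 0"
  shows "(poisson_kernel has_derivative (\<lambda>h. poisson_kernel_deriv h w)) (at w)"
proof -
  have "w \<noteq> 0" using assms by auto
  from has_derivative_divide_norm_power[OF has_derivative_snd[OF has_derivative_ident] this, of "DIM('a) + 1"]
  show ?thesis
    unfolding poisson_kernel_def[abs_def] poisson_kernel_deriv_def
    by (rule has_derivative_eq_rhs) (simp add: eval_nat_numeral)
qed

lemma poisson_kernel_deriv_has_derivative:
  fixes w :: "'a::euclidean_space \<times> real"
  assumes "snd w > 0"
  shows "(poisson_kernel_deriv b has_derivative (\<lambda>h. poisson_kernel_deriv2 b h w)) (at w)"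
proof -
  have w0: "w \<noteq> 0" using assms by auto
  have p: "((\<lambda>w. real (DIM('a) + 1) * snd w * (w \<bullet> b)) has_derivative
    (\<lambda>h. real (DIM('a) + 1) * (snd w * (h \<bullet> b) + snd h * (w \<bullet> b)))) (at w)"
    by (auto intro!: derivative_eq_intros simp: algebra_simps)
  from has_derivative_diff[OF has_derivative_divide_norm_power[OF has_derivative_const w0, of "snd b" "DIM('a) + 1"]
      has_derivative_divide_norm_power[OF p w0, of "DIM('a) + 3"]]
  show ?thesis
    unfolding poisson_kernel_deriv_def[abs_def]
    by (rule has_derivative_eq_rhs)
       (simp add: poisson_kernel_deriv2_def fun_eq_iff eval_nat_numeral inner_commute[of b] algebra_simps add_divide_distrib diff_divide_distrib)
qed

text \<open>With N = \<open>DIM('a) + 1\<close>, the coordinate sums reduce the two terms to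
  \<open>snd w / norm w ^ (N + 2)\<close> with coefficients -N (N + 2) and N (N + 2).\<close>

lemma poisson_kernel_deriv2_trace:
  fixes w :: "'a::euclidean_space \<times> real"
  assumes "w \<noteq> 0"
  shows "(\<Sum>b\<in>Basis. poisson_kernel_deriv2 b b w) = 0"
proof -
  let ?N = "real (DIM('a) + 1)"
  have s: "(\<Sum>b\<in>Basis. snd b * (w \<bullet> b)) = snd w"
    using euclidean_inner[of "(0, 1)" w] by (simp only: inner_prod_def) (simp add: mult.commute)
  have bb: "(\<Sum>b\<in>Basis. b \<bullet> (b::'a \<times> real)) = ?N"
    by simp
  have ww: "(\<Sum>b\<in>Basis. (w \<bullet> b) * (w \<bullet> b)) = (norm w)\<^sup>2"
    using euclidean_inner[of w w] by (simp add: power2_norm_eq_inner)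
  have "(\<Sum>b\<in>Basis. poisson_kernel_deriv2 b b w)
     = - ?N * (2 * (\<Sum>b\<in>Basis. snd b * (w \<bullet> b)) + snd w * (\<Sum>b\<in>Basis. b \<bullet> (b::'a \<times> real))) / norm w ^ (DIM('a) + 3)
     + ?N * real (DIM('a) + 3) * snd w * (\<Sum>b\<in>Basis. (w \<bullet> b) * (w \<bullet> b)) / norm w ^ (DIM('a) + 5)"
    unfolding poisson_kernel_deriv2_def sum.distrib sum_divide_distrib[symmetric] sum_distrib_left[symmetric] mult.assoc
    by simp
  also have "\<dots> = 0"
    unfolding s bb ww using assms
    by (simp add: field_simps power_add eval_nat_numeral)
  finally show ?thesis .
qed

text \<open>
  A common majorant, up to constants, of the Poisson kernel and of its first and second derivatives;
  it is comparable to \<open>\<bar>w\<bar>\<close> to the power \<open>-n\<close> as long as \<open>w\<^sub>n\<close> stays in a compact subset of the positive reals.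
\<close>

definition kernel_bound :: "'a::euclidean_space \<times> real \<Rightarrow> real" where
  "kernel_bound w = (snd w + 1 / snd w) / norm w ^ (DIM('a) + 1)"

text \<open>The prefactor of \<open>kernel_bound\<close> is thus at least 1, which covers the first
  derivative. Its summand \<open>snd w\<close> covers the kernel itself, and
  \<open>1 / snd w\<close> the second derivative, which decays by one more power of the
  norm.\<close>

lemma one_le_add_inverse:
  fixes t :: real
  assumes "t > 0"
  shows "1 \<le> t + 1 / t"
proof (cases "t \<ge> 1")
  case True
  then show ?thesis by (simp add: add_increasing2)
next
  case False
  then have "1 \<le> 1 / t" using assms by simp
  then show ?thesis using assms by linarith
qed

lemma snd_le_norm: "\<bar>snd (w::'a::euclidean_space \<times> real)\<bar> \<le> norm w"
  using norm_snd_le[of "snd w" "fst w"] by simp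

lemma poisson_kernel_bound:
  assumes "snd w > 0"
  shows "\<bar>poisson_kernel w\<bar> \<le> kernel_bound w"
  using assms by (simp add: poisson_kernel_def kernel_bound_def divide_right_mono)

lemma poisson_kernel_deriv_bound:
  fixes w b :: "'a::euclidean_space \<times> real"
  assumes "snd w > 0"
  shows "\<bar>poisson_kernel_deriv b w\<bar> \<le> real (DIM('a) + 2) * kernel_bound w * norm b"
proof -
  let ?n = "DIM('a) + 1"
  define r where "r = norm w"
  have r: "r > 0" using assms by (auto simp: r_def)
  have "\<bar>poisson_kernel_deriv b w\<bar> \<le> \<bar>snd b\<bar> / r ^ (DIM('a) + 1) + real ?n * \<bar>snd w\<bar> * \<bar>w \<bullet> b\<bar> / r ^ (DIM('a) + 3)"
    unfolding poisson_kernel_deriv_def r_def[symmetric] using r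
    by (intro order_trans[OF abs_triangle_ineq4]) (simp add: abs_mult)
  also have "\<dots> \<le> norm b / r ^ (DIM('a) + 1) + real ?n * r * (r * norm b) / r ^ (DIM('a) + 3)"
    unfolding r_def using Cauchy_Schwarz_ineq2[of w b]
    by (intro add_mono divide_right_mono mult_mono snd_le_norm) auto
  also have "\<dots> = real (DIM('a) + 2) * norm b * (1 / r ^ (DIM('a) + 1))"
    using r by (simp add: field_simps power_add eval_nat_numeral)
  also have "\<dots> \<le> real (DIM('a) + 2) * norm b * kernel_bound w"
    using one_le_add_inverse[OF assms] r
    by (intro mult_left_mono) (auto simp: kernel_bound_def r_def[symmetric] divide_right_mono)
  finally show ?thesis by (simp add: mult_ac)
qed

lemma poisson_kernel_deriv2_bound:
  fixes w b c :: "'a::euclidean_space \<times> real"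
  assumes "snd w > 0"
  shows "\<bar>poisson_kernel_deriv2 b c w\<bar> \<le> (real (DIM('a) + 1) * real (DIM('a) + 6) * norm b) * kernel_bound w * norm c"
proof -
  let ?n = "DIM('a) + 1"
  define r where "r = norm w"
  have r: "r > 0" using assms by (auto simp: r_def)
  have sw: "snd w \<le> r" using snd_le_norm[of w] by (simp add: r_def)
  have cs: "\<bar>w \<bullet> b\<bar> \<le> r * norm b" "\<bar>w \<bullet> c\<bar> \<le> r * norm c" "\<bar>b \<bullet> c\<bar> \<le> norm b * norm c"
    unfolding r_def by (rule Cauchy_Schwarz_ineq2)+
  have "\<bar>poisson_kernel_deriv2 b c w\<bar>
      \<le> real ?n * (\<bar>snd b\<bar> * \<bar>w \<bullet> c\<bar> + \<bar>snd c\<bar> * \<bar>w \<bullet> b\<bar> + \<bar>snd w\<bar> * \<bar>b \<bullet> c\<bar>) / r ^ (DIM('a) + 3)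
       + real ?n * real (DIM('a) + 3) * \<bar>snd w\<bar> * \<bar>w \<bullet> b\<bar> * \<bar>w \<bullet> c\<bar> / r ^ (DIM('a) + 5)"
  proof -
    have "\<bar>snd b * (w \<bullet> c) + snd c * (w \<bullet> b) + snd w * (b \<bullet> c)\<bar>
      \<le> \<bar>snd b\<bar> * \<bar>w \<bullet> c\<bar> + \<bar>snd c\<bar> * \<bar>w \<bullet> b\<bar> + \<bar>snd w\<bar> * \<bar>b \<bullet> c\<bar>"
      unfolding abs_mult[symmetric] by linarith
    then have "real ?n * \<bar>snd b * (w \<bullet> c) + snd c * (w \<bullet> b) + snd w * (b \<bullet> c)\<bar> / r ^ (DIM('a) + 3)
      \<le> real ?n * (\<bar>snd b\<bar> * \<bar>w \<bullet> c\<bar> + \<bar>snd c\<bar> * \<bar>w \<bullet> b\<bar> + \<bar>snd w\<bar> * \<bar>b \<bullet> c\<bar>) / r ^ (DIM('a) + 3)"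
      using r by (intro divide_right_mono mult_left_mono) auto
    moreover have "\<bar>poisson_kernel_deriv2 b c w\<bar>
      \<le> real ?n * \<bar>snd b * (w \<bullet> c) + snd c * (w \<bullet> b) + snd w * (b \<bullet> c)\<bar> / r ^ (DIM('a) + 3)
       + real ?n * real (DIM('a) + 3) * \<bar>snd w\<bar> * \<bar>w \<bullet> b\<bar> * \<bar>w \<bullet> c\<bar> / r ^ (DIM('a) + 5)"
      unfolding poisson_kernel_deriv2_def r_def[symmetric] using r
      by (intro order_trans[OF abs_triangle_ineq]) (simp add: abs_mult add.commute[of 1])
    ultimately show ?thesis by linarith
  qed
  also have "\<dots> \<le> real ?n * (norm b * (r * norm c) + norm c * (r * norm b) + r * (norm b * norm c)) / r ^ (DIM('a) + 3)
       + real ?n * real (DIM('a) + 3) * r * (r * norm b) * (r * norm c) / r ^ (DIM('a) + 5)"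
    using r assms sw cs
    by (intro add_mono divide_right_mono mult_mono snd_le_norm mult_nonneg_nonneg add_nonneg_nonneg) auto
  \<comment> \<open>The three products in the bracket contribute 3 and the last term
    \<open>DIM('a) + 3\<close>.\<close>
  also have "\<dots> = real ?n * real (DIM('a) + 6) * norm b * norm c * (1 / r / r ^ (DIM('a) + 1))"
    using r by (simp add: field_simps power_add eval_nat_numeral)
  also have "\<dots> \<le> real ?n * real (DIM('a) + 6) * norm b * norm c * kernel_bound w"
  proof -
    have "1 / r \<le> snd w + 1 / snd w"
      using sw assms r frac_le[of 1 1 "snd w" r] by linarith
    from divide_right_mono[OF this, of "r ^ (DIM('a) + 1)"] show ?thesis
      using r by (intro mult_left_mono) (auto simp: kernel_bound_def r_def[symmetric])
  qed
  finally show ?thesis by (simp add: mult_ac)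
qed

section \<open>Poisson integrals of bounded functions\<close>

text \<open>The substitution \<open>y = fst x - snd x *\<^sub>R s\<close> moves every x to the same
  hyperplane of points \<open>(s, 1)\<close>, up to a dilation that homogeneous kernels turn into a
  power of \<open>snd x\<close>.\<close>

lemma nn_integral_translate_boundary:
  fixes x :: "'a::euclidean_space \<times> real"
  assumes [measurable]: "F \<in> borel_measurable borel" and "snd x > 0"
  shows "(\<integral>\<^sup>+y. F (x - (y, 0)) \<partial>lborel) = ennreal (snd x ^ DIM('a)) * (\<integral>\<^sup>+s. F (snd x *\<^sub>R (s, 1)) \<partial>lborel)"
proof -
  have [measurable]: "(\<lambda>y. x - (y, 0)) \<in> borel_measurable borel"
    by (intro borel_measurable_continuous_onI continuous_intros)
  have "x - (fst x + (- snd x) *\<^sub>R s, 0) = snd x *\<^sub>R (s, 1)" for s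
    by (simp add: prod_eq_iff)
  then show ?thesis
    using assms(2) by (subst nn_integral_lborel_affine[where c="- snd x" and t="fst x"]) auto
qed

lemma kernel_decay_integrable:
  fixes x :: "'a::euclidean_space \<times> real"
  assumes "snd x > 0"
  shows "integrable lebesgue (\<lambda>y. 1 / norm (x - (y, 0)) ^ (DIM('a) + 1))"
proof -
  let ?t = "snd x"
  have [measurable]: "(\<lambda>y. x - (y, 0)) \<in> borel_measurable borel"
    by (intro borel_measurable_continuous_onI continuous_intros)
  have "(\<integral>\<^sup>+y. ennreal (1 / norm (x - (y, 0)) ^ (DIM('a) + 1)) \<partial>lborel)
    = ennreal (?t ^ DIM('a)) * (\<integral>\<^sup>+s. ennreal (1 / norm (?t *\<^sub>R (s::'a, 1::real)) ^ (DIM('a) + 1)) \<partial>lborel)"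
    by (rule nn_integral_translate_boundary[OF _ assms, where F="\<lambda>w. ennreal (1 / norm w ^ (DIM('a) + 1))"]) measurable
  also have "(\<integral>\<^sup>+s. ennreal (1 / norm (?t *\<^sub>R (s::'a, 1::real)) ^ (DIM('a) + 1)) \<partial>lborel)
    = (\<integral>\<^sup>+s. ennreal (1 / ?t ^ (DIM('a) + 1)) * ennreal (1 / norm (s::'a, 1::real) ^ (DIM('a) + 1)) \<partial>lborel)"
    using assms by (intro nn_integral_cong) (simp add: ennreal_mult[symmetric] power_mult_distrib del: scaleR_Pair)
  also have "\<dots> = ennreal (1 / ?t ^ (DIM('a) + 1)) * (\<integral>\<^sup>+s. ennreal (1 / norm (s::'a, 1::real) ^ (DIM('a) + 1)) \<partial>lborel)"
    by (rule nn_integral_cmult) measurable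
  also have "ennreal (?t ^ DIM('a)) * \<dots> < \<infinity>"
    using nn_integral_conformal_weight_finite[where 'a='a] by (simp add: ennreal_mult_less_top ennreal_less_top)
  finally have "integrable lborel (\<lambda>y. 1 / norm (x - (y, 0)) ^ (DIM('a) + 1))"
    by (intro integrableI_nonneg) auto
  then show ?thesis
    by (subst integrable_completion) auto
qed

section \<open>Essentially bounded boundary data and their convolutions\<close>

lemma Linfty_measurable: "f \<in> Linfty \<Longrightarrow> f \<in> borel_measurable lebesgue"
  by (simp add: Linfty_def)

lemma Linfty_norm_bound:
  fixes f :: "'a::euclidean_space \<Rightarrow> real"
  assumes "f \<in> Linfty"
  shows "AE y in lebesgue. \<bar>f y\<bar> \<le> Linfty_norm f" and "0 \<le> Linfty_norm f"
proof -
  let ?E = "esssup lebesgue (\<lambda>y. ereal \<bar>f y\<bar>)"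
  have AE: "AE y in lebesgue. ereal \<bar>f y\<bar> \<le> ?E" by (rule esssup_AE)
  have nz: "emeasure lebesgue (UNIV :: 'a set) \<noteq> 0" by simp
  \<comment> \<open>Lebesgue measure is not null, so the almost everywhere bound holds at some
    point. This excludes a negative infinite value, which \<open>real_of_ereal\<close> would
    silently turn into 0.\<close>
  have "\<exists>y. ereal \<bar>f y\<bar> \<le> ?E"
  proof (rule ccontr)
    assume "\<nexists>y. ereal \<bar>f y\<bar> \<le> ?E"
    with AE have "AE y in (lebesgue :: 'a measure). False" by simp
    then show False
      using nz by (auto simp: eventually_False trivial_limit_def[symmetric] ae_filter_eq_bot_iff)
  qed
  then obtain y where "ereal \<bar>f y\<bar> \<le> ?E" ..
  then have "0 \<le> ?E" by (meson abs_ge_zero ereal_less_eq(5) order_trans)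
  moreover have "?E < \<infinity>" using assms by (simp add: Linfty_def)
  ultimately have "?E = ereal (Linfty_norm f)" "0 \<le> Linfty_norm f"
    unfolding Linfty_norm_def by (cases ?E; simp)+
  with AE show "AE y in lebesgue. \<bar>f y\<bar> \<le> Linfty_norm f" "0 \<le> Linfty_norm f" by simp_all
qed

text \<open>The kernel is left general so that the Poisson kernel and its derivatives of both orders
  are treated alike.\<close>

definition boundary_convolution ::
    "('a::euclidean_space \<times> real \<Rightarrow> real) \<Rightarrow> ('a \<Rightarrow> real) \<Rightarrow> 'a \<times> real \<Rightarrow> real" where
  "boundary_convolution K f x = (LINT y|lebesgue. K (x - (y, 0)) * f y)"

lemma kernel_section_measurable:
  fixes K :: "'a::euclidean_space \<times> real \<Rightarrow> real"
  assumes "continuous_on {w. snd w > 0} K" and "snd x > 0"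
  shows "(\<lambda>y. K (x - (y, 0))) \<in> borel_measurable lborel"
proof -
  have "continuous_on UNIV (\<lambda>y. K (x - (y, 0)))"
    using assms(2) by (intro continuous_on_compose2[OF assms(1)] continuous_intros) auto
  then have "(\<lambda>y. K (x - (y, 0))) \<in> borel_measurable borel"
    by (rule borel_measurable_continuous_onI)
  then show ?thesis by simp
qed

lemma kernel_section_measurable_mult:
  fixes K :: "'a::euclidean_space \<times> real \<Rightarrow> real"
  assumes "continuous_on {w. snd w > 0} K" and "snd x > 0" and "f \<in> Linfty"
  shows "(\<lambda>y. K (x - (y, 0)) * f y) \<in> borel_measurable lebesgue"
  using measurable_completion[OF kernel_section_measurable[OF assms(1,2)]] Linfty_measurable[OF assms(3)]
  by (rule borel_measurable_times)

text \<open>One integrable majorant for all z near x, as dominated convergence requires. The radius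
  \<open>snd x / 2\<close> keeps the height of z comparable to that of x and the distances to each
  boundary point comparable as well.\<close>

lemma kernel_bound_dominated:
  fixes x :: "'a::euclidean_space \<times> real"
  assumes x: "snd x > 0" and f: "f \<in> Linfty"
  obtains g where "integrable lebesgue g" "\<And>y. 0 \<le> g y"
    "\<And>z y. z \<in> ball x (snd x / 2) \<Longrightarrow> snd z > 0 \<and> kernel_bound (z - (y, 0)) * \<bar>f y\<bar> \<le> g y"
proof
  let ?n = "DIM('a) + 1"
  define t where "t = snd x"
  have t: "t > 0" using x by (simp add: t_def)
  \<comment> \<open>The factor \<open>2 * t + 2 / t\<close> bounds \<open>snd z + 1 / snd z\<close>,
    and \<open>2 ^ ?n\<close> comes from the distance to \<open>(y, 0)\<close> at most doubling from
    z to x.\<close>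
  define g where "g y = (2 * t + 2 / t) * 2 ^ ?n * (1 / norm (x - (y, 0)) ^ ?n * \<bar>f y\<bar>)" for y
  have int: "integrable lebesgue (\<lambda>y. 1 / norm (x - (y, 0)) ^ ?n * \<bar>f y\<bar>)"
  proof (rule Bochner_Integration.integrable_bound)
    have dec: "integrable lebesgue (\<lambda>y. 1 / norm (x - (y, 0)) ^ ?n)"
      by (rule kernel_decay_integrable[OF x])
    then show "integrable lebesgue (\<lambda>y. 1 / norm (x - (y, 0)) ^ ?n * Linfty_norm f)"
      by (rule integrable_mult_left)
    show "(\<lambda>y. 1 / norm (x - (y, 0)) ^ ?n * \<bar>f y\<bar>) \<in> borel_measurable lebesgue"
      using borel_measurable_integrable[OF dec] Linfty_measurable[OF f] by measurable
    show "AE y in lebesgue. norm (1 / norm (x - (y, 0)) ^ ?n * \<bar>f y\<bar>) \<le> norm (1 / norm (x - (y, 0)) ^ ?n * Linfty_norm f)"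
      using Linfty_norm_bound[OF f]
      by (auto simp: abs_mult intro!: divide_right_mono mult_left_mono elim!: eventually_mono)
  qed
  then show "integrable lebesgue g"
    unfolding g_def by (rule integrable_mult_right)
  show "0 \<le> g y" for y
    using t by (simp add: g_def)
  fix z y assume "z \<in> ball x (snd x / 2)"
  then have d: "norm (x - z) < t / 2" by (simp add: dist_norm t_def)
  have ds: "\<bar>t - snd z\<bar> < t / 2"
    using snd_le_norm[of "x - z"] d by (simp add: t_def)
  then have z: "t / 2 < snd z" "snd z < 2 * t" using t by linarith+
  have zp: "snd z > 0" using z t by linarith
  define r where "r = norm (z - (y, 0))"
  have rz: "snd z \<le> r" using snd_le_norm[of "z - (y, 0)"] zp by (simp add: r_def)
  have rp: "r > 0" using rz zp by linarith
  have "norm (x - (y, 0)) \<le> norm (x - z) + r"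
    unfolding r_def using dist_triangle[of x "(y, 0)" z] by (simp only: dist_norm)
  then have r2: "norm (x - (y, 0)) \<le> 2 * r" using d z rz by linarith
  have xp: "norm (x - (y, 0)) > 0"
    using t by (auto simp: t_def)
  have "snd z + 1 / snd z \<le> 2 * t + 2 / t"
    using z t frac_le[of 1 1 "t / 2" "snd z"] by simp
  then have "(snd z + 1 / snd z) / r ^ ?n \<le> (2 * t + 2 / t) / r ^ ?n"
    using rp by (intro divide_right_mono) auto
  also have "1 / r ^ ?n \<le> 2 ^ ?n * (1 / norm (x - (y, 0)) ^ ?n)"
  proof -
    have "norm (x - (y, 0)) ^ ?n \<le> (2 * r) ^ ?n" using r2 by (rule power_mono) simp
    then show ?thesis using rp xp by (simp add: field_simps power_mult_distrib)
  qed
  then have "(2 * t + 2 / t) / r ^ ?n \<le> (2 * t + 2 / t) * (2 ^ ?n * (1 / norm (x - (y, 0)) ^ ?n))"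
    using t mult_left_mono[of "1 / r ^ ?n" "2 ^ ?n * (1 / norm (x - (y, 0)) ^ ?n)" "2 * t + 2 / t"] by simp
  finally have "kernel_bound (z - (y, 0)) \<le> (2 * t + 2 / t) * (2 ^ ?n * (1 / norm (x - (y, 0)) ^ ?n))"
    by (simp add: kernel_bound_def r_def)
  from mult_right_mono[OF this, of "\<bar>f y\<bar>"] zp
  show "snd z > 0 \<and> kernel_bound (z - (y, 0)) * \<bar>f y\<bar> \<le> g y"
    by (simp add: g_def mult.assoc)
qed

lemma boundary_convolution_integrable:
  fixes K :: "'a::euclidean_space \<times> real \<Rightarrow> real"
  assumes K: "continuous_on {w. snd w > 0} K"
    and bound: "\<And>w. snd w > 0 \<Longrightarrow> \<bar>K w\<bar> \<le> A * kernel_bound w" "A \<ge> 0"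
    and x: "snd x > 0" and f: "f \<in> Linfty"
  shows "integrable lebesgue (\<lambda>y. K (x - (y, 0)) * f y)"
proof -
  obtain g where g: "integrable lebesgue g"
    "\<And>z y. z \<in> ball x (snd x / 2) \<Longrightarrow> snd z > 0 \<and> kernel_bound (z - (y, 0)) * \<bar>f y\<bar> \<le> g y"
    using kernel_bound_dominated[OF x f] by metis
  show ?thesis
  proof (rule Bochner_Integration.integrable_bound)
    show "integrable lebesgue (\<lambda>y. A * g y)" using g(1) by simp
    show "(\<lambda>y. K (x - (y, 0)) * f y) \<in> borel_measurable lebesgue"
      by (rule kernel_section_measurable_mult[OF K x f])
    have "\<bar>K (x - (y, 0)) * f y\<bar> \<le> A * g y" for y
    proof -
      have "\<bar>K (x - (y, 0))\<bar> * \<bar>f y\<bar> \<le> A * kernel_bound (x - (y, 0)) * \<bar>f y\<bar>"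
        using x by (intro mult_right_mono bound(1)) auto
      also have "\<dots> \<le> A * g y"
        using g(2)[of x y] x bound(2) by (simp add: mult.assoc mult_left_mono)
      finally show ?thesis by (simp add: abs_mult)
    qed
    then show "AE y in lebesgue. norm (K (x - (y, 0)) * f y) \<le> norm (A * g y)"
      by (intro AE_I2) (metis abs_ge_self order_trans real_norm_def)
  qed
qed

lemma boundary_convolution_continuous:
  fixes K :: "'a::euclidean_space \<times> real \<Rightarrow> real"
  assumes K: "continuous_on {w. snd w > 0} K"
    and bound: "\<And>w. snd w > 0 \<Longrightarrow> \<bar>K w\<bar> \<le> A * kernel_bound w" "A \<ge> 0"
    and f: "f \<in> Linfty"
  shows "continuous_on {w. snd w > 0} (boundary_convolution K f)"
proof -
  have op: "open {w::'a \<times> real. snd w > 0}"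
    by (intro open_Collect_less continuous_intros)
  have "isCont (boundary_convolution K f) x" if x: "snd x > 0" for x
  proof -
    obtain g where g: "integrable lebesgue g"
      "\<And>z y. z \<in> ball x (snd x / 2) \<Longrightarrow> snd z > 0 \<and> kernel_bound (z - (y, 0)) * \<bar>f y\<bar> \<le> g y"
      using kernel_bound_dominated[OF x f] by metis
    show ?thesis
      unfolding isCont_def boundary_convolution_def
    proof (rule tendsto_integral_dominated[where e="snd x / 2" and g="\<lambda>y. A * g y"])
      show "(\<lambda>y. K (z - (y, 0)) * f y) \<in> borel_measurable lebesgue" if "z \<in> ball x (snd x / 2)" for z
        using g(2)[OF that] by (intro kernel_section_measurable_mult[OF K _ f]) auto
      show "\<bar>K (z - (y, 0)) * f y\<bar> \<le> A * g y" if z: "z \<in> ball x (snd x / 2)" for z y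
      proof -
        have "\<bar>K (z - (y, 0))\<bar> * \<bar>f y\<bar> \<le> A * kernel_bound (z - (y, 0)) * \<bar>f y\<bar>"
          using g(2)[OF z] by (intro mult_right_mono bound(1)) auto
        also have "\<dots> \<le> A * g y"
          using g(2)[OF z, of y] bound(2) by (simp add: mult.assoc mult_left_mono)
        finally show ?thesis by (simp add: abs_mult)
      qed
      show "((\<lambda>z. K (z - (y, 0)) * f y) \<longlongrightarrow> K (x - (y, 0)) * f y) (at x)" for y
      proof -
        have "x - (y, 0) \<in> {w. snd w > 0}" using x by simp
        then have "isCont K (x - (y, 0))"
          using K op continuous_on_eq_continuous_at by blast
        moreover have "isCont (\<lambda>z. z - (y, 0)) x" by (intro continuous_intros)
        ultimately have "isCont (\<lambda>z. K (z - (y, 0))) x"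
          by (rule isCont_o2[rotated])
        then show ?thesis
          unfolding isCont_def by (intro tendsto_intros)
      qed
    qed (use x g kernel_section_measurable_mult[OF K x f] in auto)
  qed
  then show ?thesis
    by (simp add: continuous_on_eq_continuous_at[OF op])
qed

text \<open>Applied twice: with \<open>poisson_kernel\<close> as \<open>K\<close> for the gradient,
  then with \<open>poisson_kernel_deriv b\<close> for the second derivatives.\<close>

lemma boundary_convolution_has_derivative:
  fixes K :: "'a::euclidean_space \<times> real \<Rightarrow> real"
  assumes K': "\<And>w. snd w > 0 \<Longrightarrow> (K has_derivative (\<lambda>h. K' h w)) (at w)"
    and cont: "\<And>h. continuous_on {w. snd w > 0} (K' h)"
    and bound: "\<And>w. snd w > 0 \<Longrightarrow> \<bar>K w\<bar> \<le> A * kernel_bound w" "A \<ge> 0"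
    and bound': "\<And>w h. snd w > 0 \<Longrightarrow> \<bar>K' h w\<bar> \<le> B * kernel_bound w * norm h" "B \<ge> 0"
    and x: "snd x > 0" and f: "f \<in> Linfty"
  shows "(boundary_convolution K f has_derivative (\<lambda>h. boundary_convolution (K' h) f x)) (at x)"
proof -
  have K: "continuous_on {w. snd w > 0} K"
    by (intro continuous_at_imp_continuous_on ballI has_derivative_continuous[OF K']) auto
  obtain g where g: "integrable lebesgue g" "\<And>y. 0 \<le> g y"
    "\<And>z y. z \<in> ball x (snd x / 2) \<Longrightarrow> snd z > 0 \<and> kernel_bound (z - (y, 0)) * \<bar>f y\<bar> \<le> g y"
    using kernel_bound_dominated[OF x f] by metis
  show ?thesis
    unfolding boundary_convolution_def
  proof (rule has_derivative_integral_dominated[where e="snd x / 2" and g="\<lambda>y. B * g y"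
        and D="\<lambda>z y h. K' h (z - (y, 0)) * f y"])
    show "integrable lebesgue (\<lambda>y. K (z - (y, 0)) * f y)" if "z \<in> ball x (snd x / 2)" for z
      using g(3)[OF that] by (intro boundary_convolution_integrable[OF K bound _ f]) auto
    show "((\<lambda>z. K (z - (y, 0)) * f y) has_derivative (\<lambda>h. K' h (z - (y, 0)) * f y)) (at z)"
      if z: "z \<in> ball x (snd x / 2)" for z y
    proof (rule has_derivative_mult_left)
      have "((\<lambda>z. z - (y, 0)) has_derivative (\<lambda>h. h)) (at z)"
        by (auto intro!: derivative_eq_intros)
      moreover have "(K has_derivative (\<lambda>h. K' h (z - (y, 0)))) (at (z - (y, 0)))"
        using g(3)[OF z] by (intro K') auto
      ultimately show "((\<lambda>z. K (z - (y, 0))) has_derivative (\<lambda>h. K' h (z - (y, 0)))) (at z)"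
        by (rule has_derivative_compose)
    qed
    show "\<bar>K' h (z - (y, 0)) * f y\<bar> \<le> B * g y * norm h" if z: "z \<in> ball x (snd x / 2)" for z y h
    proof -
      have "\<bar>K' h (z - (y, 0))\<bar> * \<bar>f y\<bar> \<le> B * kernel_bound (z - (y, 0)) * norm h * \<bar>f y\<bar>"
        using g(3)[OF z] by (intro mult_right_mono bound'(1)) auto
      also have "\<dots> = B * (kernel_bound (z - (y, 0)) * \<bar>f y\<bar>) * norm h"
        by (simp add: mult_ac)
      also have "\<dots> \<le> B * g y * norm h"
        using g(3)[OF z, of y] bound'(2) by (intro mult_right_mono mult_left_mono) auto
      finally show ?thesis by (simp add: abs_mult)
    qed
    show "(\<lambda>y. K' h (x - (y, 0)) * f y) \<in> borel_measurable lebesgue" for h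
      by (rule kernel_section_measurable_mult[OF cont x f])
  qed (use x g bound' in auto)
qed

lemma poisson_kernel_deriv_continuous:
  "continuous_on {w. snd w > 0} (poisson_kernel_deriv (b :: 'a::euclidean_space \<times> real))"
  by (intro continuous_at_imp_continuous_on ballI has_derivative_continuous[OF poisson_kernel_deriv_has_derivative]) auto

lemma poisson_kernel_deriv2_continuous:
  "continuous_on {w. snd w > 0} (poisson_kernel_deriv2 (b :: 'a::euclidean_space \<times> real) c)"
proof (rule continuous_at_imp_continuous_on, rule ballI)
  fix w :: "'a \<times> real"
  assume "w \<in> {w. snd w > 0}"
  then have "norm w ^ k \<noteq> 0" for k by auto
  then show "isCont (poisson_kernel_deriv2 b c) w"
    unfolding poisson_kernel_deriv2_def[abs_def]
    by (intro isCont_add isCont_divide isCont_mult isCont_power isCont_norm isCont_snd isCont_inner continuous_const continuous_ident)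
qed

section \<open>Derivatives and harmonicity of Poisson integrals\<close>

lemma poisson_integral_conv:
  fixes f :: "real^'m \<Rightarrow> real"
  shows "poisson_integral f x = 2 / sphere_area (CARD('m) + 1) * boundary_convolution poisson_kernel f x"
proof -
  have "snd x / norm ((y, 0) - x) ^ (CARD('m) + 1) * f y = poisson_kernel (x - (y, 0)) * f y" for y
    by (simp add: poisson_kernel_def norm_minus_commute[of "(y, 0)" x])
  then show ?thesis
    unfolding poisson_integral_def boundary_convolution_def by presburger
qed

lemma open_half_space: "open (half_space :: ((real^'m) \<times> real) set)"
  unfolding half_space_def by (intro open_Collect_less continuous_intros)

lemma boundary_values_has_derivative:
  fixes f :: "real^'m \<Rightarrow> real"
  assumes u: "boundary_values u f" and x: "x \<in> half_space"
  shows "(u has_derivative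
    (\<lambda>h. 2 / sphere_area (CARD('m) + 1) * boundary_convolution (poisson_kernel_deriv h) f x)) (at x)"
\<comment> \<open>\<open>u\<close> agrees with the Poisson integral only on
  \<open>half_space\<close> and is arbitrary elsewhere; openness lets the derivative pass from one
  to the other.\<close>
proof (rule has_derivative_transform_within_open[OF _ open_half_space x])
  have "snd x > 0" "f \<in> Linfty"
    using x u by (auto simp: half_space_def boundary_values_def)
  then show "((\<lambda>x. 2 / sphere_area (CARD('m) + 1) * boundary_convolution poisson_kernel f x) has_derivative
    (\<lambda>h. 2 / sphere_area (CARD('m) + 1) * boundary_convolution (poisson_kernel_deriv h) f x)) (at x)"
    using poisson_kernel_bound
    by (intro has_derivative_mult_right, intro boundary_convolution_has_derivative[OF poisson_kernel_has_derivative
          poisson_kernel_deriv_continuous _ _ poisson_kernel_deriv_bound, where A=1]) auto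
  show "2 / sphere_area (CARD('m) + 1) * boundary_convolution poisson_kernel f y = u y" if "y \<in> half_space" for y
    using u that by (simp add: boundary_values_def poisson_integral_conv)
qed

lemma partial_eq: "(u has_derivative D) (at x) \<Longrightarrow> partial b u x = D b"
  using frechet_derivative_at[of u D x] by (simp add: partial_def)

lemma grad_inner:
  assumes D: "(u has_derivative D) (at x)"
  shows "grad u x \<bullet> h = D h"
proof -
  have lin: "linear D"
    using D by (rule has_derivative_linear)
  have "D h = D (\<Sum>b\<in>Basis. (h \<bullet> b) *\<^sub>R b)"
    by (simp add: euclidean_representation)
  also have "\<dots> = (\<Sum>b\<in>Basis. (h \<bullet> b) * D b)"
    by (simp add: linear_sum[OF lin] linear_scale[OF lin])
  also have "\<dots> = grad u x \<bullet> h"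
    by (simp add: grad_def partial_eq[OF D] inner_sum_left mult.commute inner_commute[of h])
  finally show ?thesis ..
qed

text \<open>Differentiating twice under the integral moves the Laplacian onto the kernel, where it
  vanishes for every boundary point y by \<open>poisson_kernel_deriv2_trace\<close>.\<close>

lemma boundary_values_harmonic:
  fixes f :: "real^'m \<Rightarrow> real"
  assumes u: "boundary_values u f"
  shows "harmonic_on half_space u"
proof -
  let ?c = "2 / sphere_area (CARD('m) + 1)"
  have f: "f \<in> Linfty" using u by (simp add: boundary_values_def)
  have p1: "partial b u x = ?c * boundary_convolution (poisson_kernel_deriv b) f x" if "x \<in> half_space" for b x
    by (rule partial_eq[OF boundary_values_has_derivative[OF u that]])
  have d2: "(partial b u has_derivative (\<lambda>h. ?c * boundary_convolution (poisson_kernel_deriv2 b h) f x)) (at x)"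
    if x: "x \<in> half_space" for b x
  proof (rule has_derivative_transform_within_open[OF _ open_half_space x])
    have "snd x > 0" using x by (simp add: half_space_def)
    then show "((\<lambda>x. ?c * boundary_convolution (poisson_kernel_deriv b) f x) has_derivative
      (\<lambda>h. ?c * boundary_convolution (poisson_kernel_deriv2 b h) f x)) (at x)"
      using f poisson_kernel_deriv_bound[of _ b]
      by (intro has_derivative_mult_right, intro boundary_convolution_has_derivative[OF poisson_kernel_deriv_has_derivative
            poisson_kernel_deriv2_continuous _ _ poisson_kernel_deriv2_bound,
            where A="real (DIM(real^'m) + 2) * norm b"]) (auto simp: mult_ac)
  qed (simp add: p1)
  have p2: "partial c (partial b u) x = ?c * boundary_convolution (poisson_kernel_deriv2 b c) f x"
    if "x \<in> half_space" for b c x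
    by (rule partial_eq[OF d2[OF that]])
  have bound2: "\<bar>poisson_kernel_deriv2 b c w\<bar> \<le> (real (DIM(real^'m) + 1) * real (DIM(real^'m) + 6) * norm b * norm c) * kernel_bound w"
    if "snd w > 0" for b c w :: "(real^'m) \<times> real"
    using poisson_kernel_deriv2_bound[OF that, of b c] by (simp add: mult_ac)
  show ?thesis
    unfolding harmonic_on_def
  proof (intro conjI ballI)
    show "u differentiable at x" if "x \<in> half_space" for x
      using boundary_values_has_derivative[OF u that] by (rule differentiableI)
    show "partial b u differentiable at x" if "x \<in> half_space" for b x
      using d2[OF that] by (rule differentiableI)
    show "continuous_on half_space (partial c (partial b u))" for b c
    proof -
      have "continuous_on half_space (\<lambda>x. ?c * boundary_convolution (poisson_kernel_deriv2 b c) f x)"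
        unfolding half_space_def
        by (intro continuous_intros boundary_convolution_continuous[OF poisson_kernel_deriv2_continuous bound2 _ f]) auto
      then show ?thesis
        by (rule continuous_on_eq) (simp add: p2)
    qed
    show "(\<Sum>b\<in>Basis. partial b (partial b u) x) = 0" if x: "x \<in> half_space" for x
    proof -
      have sx: "snd x > 0" using x by (simp add: half_space_def)
      have "(\<Sum>b\<in>Basis. partial b (partial b u) x)
          = ?c * (\<Sum>b\<in>Basis. LINT y|lebesgue. poisson_kernel_deriv2 b b (x - (y, 0)) * f y)"
        by (simp add: p2[OF x] boundary_convolution_def sum_distrib_left)
      also have "(\<Sum>b\<in>Basis. LINT y|lebesgue. poisson_kernel_deriv2 b b (x - (y, 0)) * f y)
          = (LINT y|lebesgue. (\<Sum>b\<in>Basis. poisson_kernel_deriv2 b b (x - (y, 0)) * f y))"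
        by (intro Bochner_Integration.integral_sum[symmetric]
            boundary_convolution_integrable[OF poisson_kernel_deriv2_continuous bound2 _ sx f]) auto
      also have "\<dots> = 0"
      proof -
        have "x - (y, 0) \<noteq> 0" for y
          using sx by (auto simp: prod_eq_iff)
        then show ?thesis
          by (simp add: sum_distrib_right[symmetric] poisson_kernel_deriv2_trace)
      qed
      finally show ?thesis by simp
    qed
  qed
qed

section \<open>The sharp gradient estimate\<close>

text \<open>With n = \<open>DIM('a) + 1\<close>, the differentiated kernel is homogeneous of degree
  -n and the substitution contributes the power n - 1 of \<open>snd x\<close>. What remains is
  \<open>1 / snd x\<close>, the entire dependence of the sharp constant on x.\<close>

lemma nn_integral_poisson_kernel_deriv:
  fixes x z :: "'a::euclidean_space \<times> real"
  assumes x: "snd x > 0"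
  shows "(\<integral>\<^sup>+y. ennreal \<bar>poisson_kernel_deriv z (x - (y, 0))\<bar> \<partial>lborel) =
    ennreal (1 / snd x) * (\<integral>\<^sup>+s. ennreal \<bar>snd z - real (DIM('a) + 1) * ((s, 1) \<bullet> z) / (norm (s::'a, 1::real))\<^sup>2\<bar>
      * ennreal (1 / norm (s, 1::real) ^ (DIM('a) + 1)) \<partial>lborel)"
proof -
  let ?n = "DIM('a) + 1" and ?t = "snd x"
  let ?q = "\<lambda>s::'a. snd z - real ?n * ((s, 1) \<bullet> z) / (norm (s, 1::real))\<^sup>2"
  have [measurable]: "poisson_kernel_deriv z \<in> borel_measurable borel"
    unfolding poisson_kernel_deriv_def[abs_def]
    by (intro borel_measurable_diff borel_measurable_divide; intro borel_measurable_continuous_onI continuous_intros)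
  have [measurable]: "(\<lambda>s::'a. (s, 1::real)) \<in> borel_measurable borel"
    by (intro borel_measurable_continuous_onI continuous_intros)
  have scale: "\<bar>poisson_kernel_deriv z (?t *\<^sub>R (s, 1))\<bar> = 1 / ?t ^ ?n * (\<bar>?q s\<bar> * (1 / norm (s, 1::real) ^ ?n))" for s :: 'a
  proof -
    define r where "r = norm (s, 1::real)"
    have r: "r > 0" by (simp add: r_def norm_Pair add_nonneg_pos)
    have nr: "norm (?t *\<^sub>R (s, 1::real)) = ?t * r"
      using x by (simp add: r_def del: scaleR_Pair)
    have "poisson_kernel_deriv z (?t *\<^sub>R (s, 1)) = 1 / ?t ^ ?n * (?q s * (1 / r ^ ?n))"
    proof -
      have "poisson_kernel_deriv z (?t *\<^sub>R (s, 1))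
        = snd z / (?t * r) ^ (DIM('a) + 1) - real ?n * ?t * (?t * ((s, 1) \<bullet> z)) / (?t * r) ^ (DIM('a) + 3)"
        unfolding poisson_kernel_deriv_def nr by (simp del: scaleR_Pair inner_Pair)
      also have "\<dots> = (snd z - real ?n * ((s, 1) \<bullet> z) / r\<^sup>2) / (?t * r) ^ ?n"
      proof -
        have "a / P - N * ?t * (?t * A) / (P * (?t * r)\<^sup>2) = (a - N * A / r\<^sup>2) / P" if "P > 0" for a A N P
          using that r x by (simp add: field_simps power2_eq_square)
        moreover have "(?t * r) ^ (DIM('a) + 3) = (?t * r) ^ ?n * (?t * r)\<^sup>2"
          by (simp add: eval_nat_numeral)
        ultimately show ?thesis
          using r x by (simp only: zero_less_power mult_pos_pos)
      qed
      finally show ?thesis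
        unfolding r_def[symmetric] by (simp add: power_mult_distrib del: power_Suc)
    qed
    then show ?thesis
      using r x unfolding r_def by (simp add: abs_mult)
  qed
  have "(\<integral>\<^sup>+y. ennreal \<bar>poisson_kernel_deriv z (x - (y, 0))\<bar> \<partial>lborel)
     = ennreal (?t ^ DIM('a)) * (\<integral>\<^sup>+s. ennreal \<bar>poisson_kernel_deriv z (?t *\<^sub>R (s, 1))\<bar> \<partial>lborel)"
    by (rule nn_integral_translate_boundary[OF _ x, where F="\<lambda>w. ennreal \<bar>poisson_kernel_deriv z w\<bar>"]) measurable
  also have "(\<integral>\<^sup>+s. ennreal \<bar>poisson_kernel_deriv z (?t *\<^sub>R (s, 1))\<bar> \<partial>lborel)
     = (\<integral>\<^sup>+s. ennreal (1 / ?t ^ ?n) * (ennreal \<bar>?q s\<bar> * ennreal (1 / norm (s, 1::real) ^ ?n)) \<partial>lborel)"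
  proof -
    have mult3: "ennreal (a * (b * c)) = ennreal a * (ennreal b * ennreal c)" if "0 \<le> a" "0 \<le> b" "0 \<le> c" for a b c
      using that by (simp add: ennreal_mult)
    show ?thesis
      unfolding scale by (intro nn_integral_cong mult3) (use x in auto)
  qed
  also have "\<dots> = ennreal (1 / ?t ^ ?n) * (\<integral>\<^sup>+s. ennreal \<bar>?q s\<bar> * ennreal (1 / norm (s, 1::real) ^ ?n) \<partial>lborel)"
    by (rule nn_integral_cmult) measurable
  also have "ennreal (?t ^ DIM('a)) * \<dots> = ennreal (1 / ?t) * (\<integral>\<^sup>+s. ennreal \<bar>?q s\<bar> * ennreal (1 / norm (s, 1::real) ^ ?n) \<partial>lborel)"
  proof -
    have "ennreal (?t ^ DIM('a)) * ennreal (1 / ?t ^ ?n) = ennreal (1 / ?t)"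
      using x by (simp add: ennreal_mult[symmetric])
    then show ?thesis by (simp add: mult.assoc[symmetric])
  qed
  finally show ?thesis .
qed

text \<open>The \<open>L\<^sup>1\<close> norm of the normal derivative of the Poisson kernel, up to the factor \<open>2 / \<omega>\<^sub>n\<close>.\<close>

definition poisson_gradient_mass :: "'a::euclidean_space \<times> real \<Rightarrow> real" where
  "poisson_gradient_mass x =
    2 * sphere_area DIM('a) * sqrt (real DIM('a)) ^ DIM('a) / sqrt (real (DIM('a) + 1)) ^ (DIM('a) + 1) / snd x"

lemma poisson_gradient_mass_nonneg:
  fixes x :: "'a::euclidean_space \<times> real"
  assumes "snd x > 0"
  shows "poisson_gradient_mass x \<ge> 0"
  using assms sphere_area_pos[of "DIM('a)"] by (simp add: poisson_gradient_mass_def)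

lemma nn_integral_poisson_kernel_normal_deriv:
  fixes x :: "'a::euclidean_space \<times> real"
  assumes x: "snd x > 0"
  shows "(\<integral>\<^sup>+y. ennreal \<bar>poisson_kernel_deriv (0, 1) (x - (y, 0))\<bar> \<partial>lborel) = ennreal (poisson_gradient_mass x)"
    and "(\<integral>\<^sup>+s. ennreal \<bar>1 - real (DIM('a) + 1) / (norm (s::'a, 1::real))\<^sup>2\<bar>
      * ennreal (1 / norm (s, 1::real) ^ (DIM('a) + 1)) \<partial>lborel) = ennreal (snd x * poisson_gradient_mass x)"
proof -
  let ?n = "DIM('a) + 1"
  have "ennreal \<bar>1 - real ?n / (norm (s, 1::real))\<^sup>2\<bar> * ennreal (1 / norm (s, 1::real) ^ ?n)
     = ennreal \<bar>1 / norm (s::'a, 1::real) ^ (DIM('a) + 1) - real (DIM('a) + 1) / norm (s, 1::real) ^ (DIM('a) + 3)\<bar>" for s :: 'a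
  proof -
    define r where "r = norm (s, 1::real)"
    have r: "r > 0" by (simp add: r_def norm_Pair add_nonneg_pos)
    have "1 / r ^ (DIM('a) + 1) - real ?n / r ^ (DIM('a) + 3) = (1 - real ?n / r\<^sup>2) * (1 / r ^ ?n)"
      using r by (simp add: field_simps power_add eval_nat_numeral)
    then have "\<bar>1 / r ^ (DIM('a) + 1) - real ?n / r ^ (DIM('a) + 3)\<bar> = \<bar>1 - real ?n / r\<^sup>2\<bar> * (1 / r ^ ?n)"
      using r by (simp add: abs_mult)
    then show ?thesis
      unfolding r_def[symmetric] using r by (subst ennreal_mult''[symmetric]) auto
  qed
  then have "(\<integral>\<^sup>+s. ennreal \<bar>1 - real ?n / (norm (s::'a, 1::real))\<^sup>2\<bar> * ennreal (1 / norm (s, 1::real) ^ ?n) \<partial>lborel)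
      = ennreal (2 * sphere_area DIM('a) * sqrt (real DIM('a)) ^ DIM('a) / sqrt (real (DIM('a) + 1)) ^ (DIM('a) + 1))"
    using nn_integral_abs_normal_derivative[where 'a='a] by simp
  then show *: "(\<integral>\<^sup>+s. ennreal \<bar>1 - real ?n / (norm (s::'a, 1::real))\<^sup>2\<bar>
      * ennreal (1 / norm (s, 1::real) ^ ?n) \<partial>lborel) = ennreal (snd x * poisson_gradient_mass x)"
    using x by (simp add: poisson_gradient_mass_def)
  show "(\<integral>\<^sup>+y. ennreal \<bar>poisson_kernel_deriv (0, 1) (x - (y, 0))\<bar> \<partial>lborel) = ennreal (poisson_gradient_mass x)"
    using nn_integral_poisson_kernel_deriv[OF x, of "(0, 1)"] * x poisson_gradient_mass_nonneg[OF x]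
    by (simp add: inner_prod_def ennreal_mult[symmetric])
qed

lemma poisson_kernel_deriv_measurable:
  fixes x :: "'a::euclidean_space \<times> real"
  assumes "snd x > 0"
  shows "(\<lambda>y. poisson_kernel_deriv z (x - (y, 0))) \<in> borel_measurable lborel"
  by (rule kernel_section_measurable[OF poisson_kernel_deriv_continuous assms])

lemma integral_poisson_kernel_deriv_le:
  fixes x z :: "'a::euclidean_space \<times> real"
  assumes x: "snd x > 0" and z: "norm z = 1"
  shows "integrable lebesgue (\<lambda>y. \<bar>poisson_kernel_deriv z (x - (y, 0))\<bar>)"
    and "(LINT y|lebesgue. \<bar>poisson_kernel_deriv z (x - (y, 0))\<bar>) \<le> poisson_gradient_mass x"
proof -
  note [measurable] = poisson_kernel_deriv_measurable[OF x]
  have "(\<integral>\<^sup>+y. ennreal \<bar>poisson_kernel_deriv z (x - (y, 0))\<bar> \<partial>lborel)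
      \<le> ennreal (1 / snd x) * ennreal (snd x * poisson_gradient_mass x)"
    unfolding nn_integral_poisson_kernel_deriv[OF x]
      nn_integral_poisson_kernel_normal_deriv(2)[OF x, symmetric]
    by (intro mult_left_mono nn_integral_normal_direction_maximal z) simp
  also have "\<dots> = ennreal (poisson_gradient_mass x)"
    using x poisson_gradient_mass_nonneg[OF x] by (simp add: ennreal_mult[symmetric])
  finally have le: "(\<integral>\<^sup>+y. ennreal \<bar>poisson_kernel_deriv z (x - (y, 0))\<bar> \<partial>lborel) \<le> ennreal (poisson_gradient_mass x)" .
  \<comment> \<open>The finite bound just obtained is itself the proof of integrability.\<close>
  then have int: "integrable lborel (\<lambda>y. \<bar>poisson_kernel_deriv z (x - (y, 0))\<bar>)"
    by (intro integrableI_nonneg) (auto intro: le_less_trans simp: ennreal_less_top)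
  then show "integrable lebesgue (\<lambda>y. \<bar>poisson_kernel_deriv z (x - (y, 0))\<bar>)"
    by (subst integrable_completion) auto
  have "(LINT y|lebesgue. \<bar>poisson_kernel_deriv z (x - (y, 0))\<bar>) = (LINT y|lborel. \<bar>poisson_kernel_deriv z (x - (y, 0))\<bar>)"
    by (rule integral_completion) measurable
  also have "ennreal \<dots> \<le> ennreal (poisson_gradient_mass x)"
    using le nn_integral_eq_integral[OF int] by simp
  finally show "(LINT y|lebesgue. \<bar>poisson_kernel_deriv z (x - (y, 0))\<bar>) \<le> poisson_gradient_mass x"
    using poisson_gradient_mass_nonneg[OF x] by simp
qed

lemma integral_poisson_kernel_normal_deriv:
  fixes x :: "'a::euclidean_space \<times> real"
  assumes x: "snd x > 0"
  shows "(LINT y|lebesgue. \<bar>poisson_kernel_deriv (0, 1) (x - (y, 0))\<bar>) = poisson_gradient_mass x"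
proof -
  note [measurable] = poisson_kernel_deriv_measurable[OF x]
  have "(LINT y|lebesgue. \<bar>poisson_kernel_deriv (0, 1) (x - (y, 0))\<bar>) = (LINT y|lborel. \<bar>poisson_kernel_deriv (0, 1) (x - (y, 0))\<bar>)"
    by (rule integral_completion) measurable
  also have "\<dots> = poisson_gradient_mass x"
    using poisson_gradient_mass_nonneg[OF x]
    by (subst integral_eq_nn_integral) (auto simp: nn_integral_poisson_kernel_normal_deriv(1)[OF x])
  finally show ?thesis .
qed

text \<open>The gradient is tested against its own direction, which turns its norm into a single
  directional derivative. A vanishing gradient has no direction and is treated apart.\<close>

lemma norm_grad_le:
  fixes f :: "real^'m \<Rightarrow> real"
  assumes u: "boundary_values u f" and x: "x \<in> half_space"
  shows "norm (grad u x) \<le> 2 / sphere_area (CARD('m) + 1) * poisson_gradient_mass x * Linfty_norm f"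
proof (cases "grad u x = 0")
  case True
  then show ?thesis
    using x u Linfty_norm_bound(2)[of f] poisson_gradient_mass_nonneg[of x] sphere_area_pos[of "CARD('m) + 1"]
    by (simp add: half_space_def boundary_values_def)
next
  case False
  let ?c = "2 / sphere_area (CARD('m) + 1)"
  define z where "z = sgn (grad u x)"
  have z: "norm z = 1" using False by (simp add: z_def norm_sgn)
  have sx: "snd x > 0" and f: "f \<in> Linfty"
    using x u by (auto simp: half_space_def boundary_values_def)
  have c: "?c > 0" by (simp add: sphere_area_pos)
  note int = integral_poisson_kernel_deriv_le[OF sx z]
  have intf: "integrable lebesgue (\<lambda>y. poisson_kernel_deriv z (x - (y, 0)) * f y)"
    using poisson_kernel_deriv_bound[of _ z]
    by (intro boundary_convolution_integrable[OF poisson_kernel_deriv_continuous _ _ sx f,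
          where A="real (DIM(real^'m) + 2) * norm z"]) (auto simp: mult_ac)
  have "norm (grad u x) = grad u x \<bullet> z"
    using False by (simp add: z_def sgn_div_norm power2_norm_eq_inner[symmetric] power2_eq_square)
  also have "\<dots> = ?c * boundary_convolution (poisson_kernel_deriv z) f x"
    by (rule grad_inner[OF boundary_values_has_derivative[OF u x]])
  also have "\<dots> \<le> ?c * (poisson_gradient_mass x * Linfty_norm f)"
  proof (rule mult_left_mono)
    have "boundary_convolution (poisson_kernel_deriv z) f x
        \<le> (LINT y|lebesgue. \<bar>poisson_kernel_deriv z (x - (y, 0))\<bar> * Linfty_norm f)"
      unfolding boundary_convolution_def
    proof (rule integral_mono_AE)
      show "AE y in lebesgue. poisson_kernel_deriv z (x - (y, 0)) * f y
          \<le> \<bar>poisson_kernel_deriv z (x - (y, 0))\<bar> * Linfty_norm f"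
        using Linfty_norm_bound(1)[OF f]
      proof eventually_elim
        case (elim y)
        then have "\<bar>poisson_kernel_deriv z (x - (y, 0))\<bar> * \<bar>f y\<bar> \<le> \<bar>poisson_kernel_deriv z (x - (y, 0))\<bar> * Linfty_norm f"
          by (rule mult_left_mono) simp
        then show ?case
          using abs_ge_self[of "poisson_kernel_deriv z (x - (y, 0)) * f y"] unfolding abs_mult by linarith
      qed
    qed (use intf int in auto)
    also have "\<dots> \<le> poisson_gradient_mass x * Linfty_norm f"
      using int(2) Linfty_norm_bound(2)[OF f] by (simp add: mult_right_mono)
    finally show "boundary_convolution (poisson_kernel_deriv z) f x \<le> poisson_gradient_mass x * Linfty_norm f" .
  qed (use c in simp)
  finally show ?thesis by (simp add: mult.assoc)
qed

lemma extremal_boundary_function: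
  fixes x :: "(real^'m) \<times> real"
  assumes x: "x \<in> half_space"
  obtains u f where "u \<in> h_infty" "boundary_values u f" "Linfty_norm f = 1"
    "partial (0, 1) u x = 2 / sphere_area (CARD('m) + 1) * poisson_gradient_mass x"
proof -
  have sx: "snd x > 0" using x by (simp add: half_space_def)
  define k where "k y = poisson_kernel_deriv (0, 1) (x - (y, 0))" for y
  have [measurable]: "k \<in> borel_measurable lebesgue"
    unfolding k_def[abs_def] by (rule measurable_completion[OF poisson_kernel_deriv_measurable[OF sx]])
  \<comment> \<open>The value 1 at zeros of \<open>k\<close> makes the absolute value of
    \<open>f\<close> equal to 1 everywhere, so its essential supremum is that of a constant.\<close>
  define f where "f y = (if k y \<ge> 0 then 1 else - 1 :: real)" for y
  have fm: "f \<in> borel_measurable lebesgue"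
    unfolding f_def[abs_def] by measurable
  have "(\<lambda>y. ereal \<bar>f y\<bar>) = (\<lambda>y. 1)" by (auto simp: f_def)
  moreover have "esssup lebesgue (\<lambda>y::real^'m. 1::ereal) = 1"
    by (rule esssup_const) simp
  ultimately have f: "f \<in> Linfty" "Linfty_norm f = 1"
    using fm by (simp_all add: Linfty_def Linfty_norm_def)
  have bv: "boundary_values (poisson_integral f) f"
    using f by (simp add: boundary_values_def)
  have "k y * f y = \<bar>k y\<bar>" for y by (simp add: f_def)
  then have "partial (0, 1) (poisson_integral f) x = 2 / sphere_area (CARD('m) + 1) * (LINT y|lebesgue. \<bar>k y\<bar>)"
    using partial_eq[OF boundary_values_has_derivative[OF bv x], of "(0, 1)"]
    by (simp add: boundary_convolution_def k_def[symmetric])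
  then have "partial (0, 1) (poisson_integral f) x = 2 / sphere_area (CARD('m) + 1) * poisson_gradient_mass x"
    unfolding k_def integral_poisson_kernel_normal_deriv[OF sx] .
  moreover have "poisson_integral f \<in> h_infty"
    using boundary_values_harmonic[OF bv] bv by (auto simp: h_infty_def)
  ultimately show ?thesis
    using bv f(2) that by blast
qed

text \<open>Links the integer powers of square roots that the radial integral produces to the real
  powers in the theorem.\<close>

lemma sqrt_power_self: "k > 0 \<Longrightarrow> sqrt (real k) ^ k = real k powr (real k / 2)"
  by (simp add: powr_half_sqrt[symmetric] powr_realpow[symmetric] powr_powr)

theorem theorem1:
  fixes n :: nat and x :: "(real^'m) \<times> real" and C :: real
  assumes "n \<ge> 2" and "CARD('m) = n - 1"
    and "x \<in> half_space"
    and "C = 4 * (real n - 1) powr ((real n - 1) / 2) * sphere_area (n - 1)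
             / (real n powr (real n / 2) * sphere_area n * snd x)"
  shows
    "(\<forall>u\<in>h_infty. \<forall>f. boundary_values u f \<longrightarrow> norm (grad u x) \<le> C * Linfty_norm f) \<and>
     (\<forall>C'. (\<forall>u\<in>h_infty. \<forall>f. boundary_values u f \<longrightarrow> norm (grad u x) \<le> C' * Linfty_norm f)
             \<longrightarrow> C \<le> C') \<and>
     Sup {\<bar>partial (0, 1) u x\<bar> | u f. u \<in> h_infty \<and> boundary_values u f \<and> Linfty_norm f \<le> 1}
       = Sup {norm (grad u x) | u f. u \<in> h_infty \<and> boundary_values u f \<and> Linfty_norm f \<le> 1}"
proof -
  have n: "n = CARD('m) + 1" using assms(1,2) by simp
  have sx: "snd x > 0" using assms(3) by (simp add: half_space_def)
  \<comment> \<open>The 4 is the 2 of the Poisson formula times the 2 from the rise and fall of the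
    radial antiderivative.\<close>
  have C: "C = 2 / sphere_area (CARD('m) + 1) * poisson_gradient_mass x"
    unfolding assms(4) n poisson_gradient_mass_def
    using sqrt_power_self[of "CARD('m)"] sqrt_power_self[of "CARD('m) + 1"] by (simp add: mult_ac)
  have C0: "C \<ge> 0"
    using poisson_gradient_mass_nonneg[OF sx] sphere_area_pos[of "CARD('m) + 1"] by (simp add: C)
  have upper: "norm (grad u x) \<le> C * Linfty_norm f" if "boundary_values u f" for u f
    using norm_grad_le[OF that assms(3)] by (simp add: C)
  obtain u0 f0 where ext: "u0 \<in> h_infty" "boundary_values u0 f0" "Linfty_norm f0 = 1" "partial (0, 1) u0 x = C"
    using extremal_boundary_function[OF assms(3)] unfolding C by blast
  have partial_le: "\<bar>partial (0, 1) u x\<bar> \<le> norm (grad u x)" if "boundary_values u f" for u f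
  proof -
    note D = boundary_values_has_derivative[OF that assms(3)]
    have "partial (0, 1) u x = grad u x \<bullet> (0, 1)"
      unfolding partial_eq[OF D] grad_inner[OF D] ..
    also have "\<bar>\<dots>\<bar> \<le> norm (grad u x) * norm (0 :: real^'m, 1::real)"
      by (rule Cauchy_Schwarz_ineq2)
    finally show ?thesis by (simp add: norm_Pair)
  qed
  have le_C: "norm (grad u x) \<le> C" if "boundary_values u f" "Linfty_norm f \<le> 1" for u f
    using upper[OF that(1)] mult_left_mono[OF that(2) C0] by simp
  \<comment> \<open>The normal derivative of \<open>u0\<close> is already C, so the gradient has
    norm at least C, and by \<open>le_C\<close> no more.\<close>
  have grad0: "norm (grad u0 x) = C"
    using le_C[OF ext(2)] partial_le[OF ext(2)] ext(3,4) by simp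
  \<comment> \<open>Real \<open>Sup\<close> is informative only for nonempty sets that are bounded
    above; exhibiting C as a maximum, attained at \<open>u0\<close>, settles both conditions for
    either set.\<close>
  have "Sup {\<bar>partial (0, 1) u x\<bar> | u f. u \<in> h_infty \<and> boundary_values u f \<and> Linfty_norm f \<le> 1} = C"
  proof (rule cSup_eq_maximum)
    have "C = \<bar>partial (0, 1) u0 x\<bar>" using ext(4) C0 by simp
    with ext show "C \<in> {\<bar>partial (0, 1) u x\<bar> | u f. u \<in> h_infty \<and> boundary_values u f \<and> Linfty_norm f \<le> 1}"
      by (intro CollectI exI[of _ u0] exI[of _ f0]) simp
  qed (clarify, rule order_trans[OF partial_le le_C])
  moreover have "Sup {norm (grad u x) | u f. u \<in> h_infty \<and> boundary_values u f \<and> Linfty_norm f \<le> 1} = C"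
  proof (rule cSup_eq_maximum)
    show "C \<in> {norm (grad u x) | u f. u \<in> h_infty \<and> boundary_values u f \<and> Linfty_norm f \<le> 1}"
      using ext grad0 by (intro CollectI exI[of _ u0] exI[of _ f0]) simp
  qed (clarify, rule le_C)
  moreover have "C \<le> C'"
    if "\<forall>u\<in>h_infty. \<forall>f. boundary_values u f \<longrightarrow> norm (grad u x) \<le> C' * Linfty_norm f" for C'
    using that[rule_format, OF ext(1,2)] by (simp add: grad0 ext(3))
  ultimately show ?thesis
    by (intro conjI ballI allI impI upper) simp_all
qed

end
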